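(* Let $\mathcal G$ be a categorical group with associated crossed module $\partial:E\to G$ (action $\triangleright$ of $G$ on $E$). (a) A one-dimensional (strict) categorical representation $R$ of $\mathcal G$ is completely determined by a group character $\xi_R:E\to\mathbb C^*$ (namely $\xi_R=R_p$) which is invariant under the action of $G$, i.e. $\xi_R(X\triangleright e)=\xi_R(e)$ for all $X\in G$, $e\in E$. (b) A $1$-intertwiner $(h_\bullet,\tilde h)$ between two one-dimensional (strict) categorical representations $R$ and $T$ is either zero (i.e. $h_\bullet=0$) or given by a representation $\tilde h:G\to\mathrm{GL}(h_\bullet,\mathbb C)$ such that $$\tilde h(\partial e)=\xi_R(e)^{-1}\xi_T(e)\qquad\text{for all } e\in E,$$ where the right-hand side is read as a scalar matrix of size $h_\bullet$. In particular, there is no non-zero $1$-intertwiner if the restrictions of $\xi_R$ and $\xi_T$ to $\ker\partial\subset E$ are different; and if $R=T$, then $\tilde h$ is trivial on $\partial(E)$. The composition of two $1$-intertwiners corresponds to the tensor product of the two respective representations of $G$. (c) Given two $1$-intertwiners between the same pair of one-dimensional (strict) categorical representations, a $2$-intertwiner between them is given by an ordinary intertwiner between the corresponding representations of $G$. The horizontal composition of two $2$-intertwiners corresponds to the tensor product of the respective ordinary intertwiners, and the vertical composition of two $2$-intertwiners corresponds to the ordinary (matrix) product of the two respective intertwiners.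
   Context: **Conventions.** Composition is written in diagrammatic order. **Categorical groups.** A categorical group $\mathcal G$ is a group object in the category of groupoids: a groupoid with object set $\mathcal G_0$, composition $\cdot$, and functorial product $\circ$, inverse and unit object $1$ strictly satisfying the group laws. Its crossed module $\partial:E\to G$: $G=(\mathcal G_0,\circ)$, $E=\bigcup_X\mathcal G(1,X)$ with product $\circ$, $\partial e=$ target of $e$, $X\triangleright e=1_X\circ e\circ 1_{X^{-1}}$. **$2\mathrm{Vect}$.** Objects: natural numbers $N\ge0$. $1$-morphisms $N\to M$: $N\times M$ matrices with entries in $\mathbb N$; horizontal composition is matrix multiplication. $2$-morphisms $a\to b$: matrices $\alpha$ whose entry $\alpha^i_j$ is a complex $a^i_j\times b^i_j$ matrix; vertical composition $(\alpha\cdot\beta)^i_j=\alpha^i_j\beta^i_j$, horizontal composition $(\alpha\circ\beta)^i_j=\bigoplus_k\alpha^i_k\otimes\beta^k_j$. $\mathcal{GL}(N)$ is the categorical group of invertible $1$- and $2$-morphisms in $2\mathrm{Vect}(N,N)$; its objects are the permutation matrices ($\cong S_N$), and its crossed module is the trivial map $(\mathbb C^* )^N\to S_N$ with $S_N$ permuting coordinates. **Strict categorical representation** of dimension $N$: a strict monoidal functor $R:\mathcal G\to\mathcal{GL}(N)$; equivalently a homomorphism of crossed modules, i.e. group homomorphisms $R_b:G\to S_N$ and $R_p:E\to(\mathbb C^* )^N$ with $R_b\circ\partial=1$ and $R_p(X\triangleright e)=R_b(X)\triangleright R_p(e)$. **$1$-intertwiner** $(h_\bullet,\tilde h):R\to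 T$ between strict categorical representations of dimensions $N$, $M$: a $1$-morphism $h_\bullet:N\to M$ with $2$-isomorphisms $\tilde h(X):R(X)\circ h_\bullet\to h_\bullet\circ T(X)$, $X\in\mathcal G_0$, such that $\tilde h(X\circ Y)=(1_{R(X)}\circ\tilde h(Y))\cdot(\tilde h(X)\circ1_{T(Y)})$, $\tilde h(1)=1_{h_\bullet}$, and for every morphism $f:X\to Y$ of $\mathcal G$, $(R(f)\circ1_{h_\bullet})\cdot\tilde h(Y)=\tilde h(X)\cdot(1_{h_\bullet}\circ T(f))$. For $N=M=1$, $h_\bullet$ is a single natural number. Composite: $(h\circ k)_\bullet=h_\bullet\circ k_\bullet$, $\widetilde{h\circ k}(X)=(\tilde h(X)\circ1_{k_\bullet})\cdot(1_{h_\bullet}\circ\tilde k(X))$. **$2$-intertwiner** $\phi:(h_\bullet,\tilde h)\to(k_\bullet,\tilde k)$ between $1$-intertwiners $R\to T$: a $2$-morphism $\phi:h_\bullet\to k_\bullet$ with $\tilde h(X)\cdot(\phi\circ1_{T(X)})=(1_{R(X)}\circ\phi)\cdot\tilde k(X)$ for all $X\in\mathcal G_0$. Horizontal and vertical compositions are those of $2\mathrm{Vect}$. *)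

theory Defs
  imports "Jordan_Normal_Form.Matrix" "HOL-Algebra.Coset"
begin

section \<open>Categorical groups and their crossed modules\<close>

text \<open>A groupoid together with a product on objects and a product on morphisms. The fields
  \<open>ob\<close> and \<open>ar\<close> carry both the sets of objects and morphisms and the product
  \<open>\<circ>\<close> on them; \<open>vcomp\<close> is the composition of the groupoid in diagrammatic order, so
  \<open>vcomp G f g\<close> is meaningful when \<open>tgt G f = src G g\<close>.\<close>

record ('o, 'm) catgroup =
  ob :: "'o monoid"
  ar :: "'m monoid"
  src :: "'m \<Rightarrow> 'o"
  tgt :: "'m \<Rightarrow> 'o"
  ident :: "'o \<Rightarrow> 'm"
  vcomp :: "'m \<Rightarrow> 'm \<Rightarrow> 'm"

locale groupoid =
  fixes G :: "('o, 'm) catgroup" (structure)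
  assumes src_closed: "f \<in> carrier (ar G) \<Longrightarrow> src G f \<in> carrier (ob G)"
    and tgt_closed: "f \<in> carrier (ar G) \<Longrightarrow> tgt G f \<in> carrier (ob G)"
    and ident_closed: "X \<in> carrier (ob G) \<Longrightarrow> ident G X \<in> carrier (ar G)"
    and src_ident: "X \<in> carrier (ob G) \<Longrightarrow> src G (ident G X) = X"
    and tgt_ident: "X \<in> carrier (ob G) \<Longrightarrow> tgt G (ident G X) = X"
    and vcomp_closed: "\<lbrakk>f \<in> carrier (ar G); g \<in> carrier (ar G); tgt G f = src G g\<rbrakk>
          \<Longrightarrow> vcomp G f g \<in> carrier (ar G)"
    and src_vcomp: "\<lbrakk>f \<in> carrier (ar G); g \<in> carrier (ar G); tgt G f = src G g\<rbrakk>
          \<Longrightarrow> src G (vcomp G f g) = src G f"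
    and tgt_vcomp: "\<lbrakk>f \<in> carrier (ar G); g \<in> carrier (ar G); tgt G f = src G g\<rbrakk>
          \<Longrightarrow> tgt G (vcomp G f g) = tgt G g"
    and vcomp_assoc: "\<lbrakk>f \<in> carrier (ar G); g \<in> carrier (ar G); k \<in> carrier (ar G);
            tgt G f = src G g; tgt G g = src G k\<rbrakk>
          \<Longrightarrow> vcomp G (vcomp G f g) k = vcomp G f (vcomp G g k)"
    and ident_vcomp: "f \<in> carrier (ar G) \<Longrightarrow> vcomp G (ident G (src G f)) f = f"
    and vcomp_ident: "f \<in> carrier (ar G) \<Longrightarrow> vcomp G f (ident G (tgt G f)) = f"
    and vcomp_inverse: "f \<in> carrier (ar G)
          \<Longrightarrow> \<exists>g\<in>carrier (ar G). src G g = tgt G f \<and> tgt G g = src G f \<and>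
                vcomp G f g = ident G (src G f) \<and> vcomp G g f = ident G (tgt G f)"

text \<open>Group objects in groupoids: the group laws hold strictly on objects and on morphisms, and
  the product is a functor. Functoriality of the unit and of the inverse is then automatic: for
  sources, targets and identities because \<open>src\<close>, \<open>tgt\<close>, \<open>ident\<close> are group homomorphisms, for
  composites by the lemma below.\<close>

locale categorical_group = groupoid G + ob: group "ob G" + ar: group "ar G"
  for G :: "('o, 'm) catgroup" (structure) +
  assumes src_hom: "src G \<in> hom (ar G) (ob G)"
    and tgt_hom: "tgt G \<in> hom (ar G) (ob G)"
    and ident_hom: "ident G \<in> hom (ob G) (ar G)"
    and interchange: "\<lbrakk>f \<in> carrier (ar G); f' \<in> carrier (ar G); g \<in> carrier (ar G);
            g' \<in> carrier (ar G); tgt G f = src G f'; tgt G g = src G g'\<rbrakk>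
          \<Longrightarrow> vcomp G f f' \<otimes>\<^bsub>ar G\<^esub> vcomp G g g'
              = vcomp G (f \<otimes>\<^bsub>ar G\<^esub> g) (f' \<otimes>\<^bsub>ar G\<^esub> g')"

lemma (in categorical_group) inv_vcomp:
  assumes f: "f \<in> carrier (ar G)" and g: "g \<in> carrier (ar G)" and fg: "tgt G f = src G g"
  shows "inv\<^bsub>ar G\<^esub> (vcomp G f g) = vcomp G (inv\<^bsub>ar G\<^esub> f) (inv\<^bsub>ar G\<^esub> g)"
proof -
  interpret s: group_hom "ar G" "ob G" "src G" by unfold_locales (rule src_hom)
  interpret t: group_hom "ar G" "ob G" "tgt G" by unfold_locales (rule tgt_hom)
  interpret i: group_hom "ob G" "ar G" "ident G" by unfold_locales (rule ident_hom)
  have fg': "tgt G (inv\<^bsub>ar G\<^esub> f) = src G (inv\<^bsub>ar G\<^esub> g)"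
    using f g fg by simp
  have "vcomp G (inv\<^bsub>ar G\<^esub> f) (inv\<^bsub>ar G\<^esub> g) \<otimes>\<^bsub>ar G\<^esub> vcomp G f g
        = vcomp G \<one>\<^bsub>ar G\<^esub> \<one>\<^bsub>ar G\<^esub>"
    using interchange[of "inv\<^bsub>ar G\<^esub> f" "inv\<^bsub>ar G\<^esub> g" f g] f g fg fg' by simp
  also have "\<dots> = \<one>\<^bsub>ar G\<^esub>"
    using ident_vcomp[of "\<one>\<^bsub>ar G\<^esub>"] by simp
  finally show ?thesis
    using f g fg fg' by (intro ar.inv_equality) (auto intro: vcomp_closed)
qed

text \<open>The crossed module \<open>\<partial> : E \<rightarrow> G\<close>: the group \<open>G\<close> is \<open>ob G\<close>, and \<open>\<partial>\<close> is \<open>tgt G\<close>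
  restricted to \<open>E\<close>.\<close>

definition cm_E :: "('o, 'm) catgroup \<Rightarrow> 'm monoid" where
  "cm_E G = \<lparr>carrier = {e \<in> carrier (ar G). src G e = \<one>\<^bsub>ob G\<^esub>},
             mult = mult (ar G), one = one (ar G)\<rparr>"

definition cm_bdry :: "('o, 'm) catgroup \<Rightarrow> 'm \<Rightarrow> 'o" where
  "cm_bdry G e = tgt G e"

definition cm_act :: "('o, 'm) catgroup \<Rightarrow> 'o \<Rightarrow> 'm \<Rightarrow> 'm" where
  "cm_act G X e = ident G X \<otimes>\<^bsub>ar G\<^esub> e \<otimes>\<^bsub>ar G\<^esub> ident G (inv\<^bsub>ob G\<^esub> X)"

section \<open>The 2-category 2Vect\<close>

text \<open>A 1-morphism \<open>N \<rightarrow> M\<close> is an element of \<open>carrier_mat N M\<close> over \<open>nat\<close>, and horizontal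
  composition of 1-morphisms is the product of matrices. A 2-morphism is a matrix of complex
  matrices; it determines its source and target through the dimensions of its entries.\<close>

definition hom2 :: "nat mat \<Rightarrow> nat mat \<Rightarrow> complex mat mat set" where
  "hom2 a b = {\<alpha>. b \<in> carrier_mat (dim_row a) (dim_col a) \<and>
                  \<alpha> \<in> carrier_mat (dim_row a) (dim_col a) \<and>
                  (\<forall>i<dim_row a. \<forall>j<dim_col a.
                     \<alpha> $$ (i, j) \<in> carrier_mat (a $$ (i, j)) (b $$ (i, j)))}"

definition src2 :: "complex mat mat \<Rightarrow> nat mat" where
  "src2 \<alpha> = map_mat dim_row \<alpha>"

definition tgt2 :: "complex mat mat \<Rightarrow> nat mat" where
  "tgt2 \<alpha> = map_mat dim_col \<alpha>"

definition id2 :: "nat mat \<Rightarrow> complex mat mat" where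
  "id2 a = map_mat 1\<^sub>m a"

definition vcomp2 :: "complex mat mat \<Rightarrow> complex mat mat \<Rightarrow> complex mat mat" where
  "vcomp2 \<alpha> \<beta> = mat (dim_row \<alpha>) (dim_col \<alpha>) (\<lambda>ij. \<alpha> $$ ij * \<beta> $$ ij)"

definition kronecker :: "complex mat \<Rightarrow> complex mat \<Rightarrow> complex mat" where
  "kronecker A B = mat (dim_row A * dim_row B) (dim_col A * dim_col B)
     (\<lambda>(i, j). A $$ (i div dim_row B, j div dim_col B) * B $$ (i mod dim_row B, j mod dim_col B))"

definition hcomp2 :: "complex mat mat \<Rightarrow> complex mat mat \<Rightarrow> complex mat mat" where
  "hcomp2 \<alpha> \<beta> = mat (dim_row \<alpha>) (dim_col \<beta>)
     (\<lambda>(i, j). diag_block_mat (map (\<lambda>k. kronecker (\<alpha> $$ (i, k)) (\<beta> $$ (k, j))) [0..<dim_col \<alpha>]))"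

definition iso2 :: "nat mat \<Rightarrow> nat mat \<Rightarrow> complex mat mat set" where
  "iso2 a b = {\<alpha> \<in> hom2 a b. \<exists>\<beta>\<in>hom2 b a. vcomp2 \<alpha> \<beta> = id2 a \<and> vcomp2 \<beta> \<alpha> = id2 b}"

definition inv1mor :: "nat \<Rightarrow> nat mat set" where
  "inv1mor N = {a \<in> carrier_mat N N. \<exists>b\<in>carrier_mat N N. a * b = 1\<^sub>m N \<and> b * a = 1\<^sub>m N}"

definition GL2 :: "nat \<Rightarrow> (nat mat, complex mat mat) catgroup" where
  "GL2 N = \<lparr>
     ob = \<lparr>carrier = inv1mor N, mult = (*), one = 1\<^sub>m N\<rparr>,
     ar = \<lparr>carrier = (\<Union>a\<in>inv1mor N. \<Union>b\<in>inv1mor N. iso2 a b), mult = hcomp2, one = id2 (1\<^sub>m N)\<rparr>,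
     src = src2, tgt = tgt2, ident = id2, vcomp = vcomp2\<rparr>"

section \<open>Strict categorical representations and their intertwiners\<close>

record ('o, 'm, 'p, 'q) catfunctor =
  on_ob :: "'o \<Rightarrow> 'p"
  on_ar :: "'m \<Rightarrow> 'q"

definition strict_monoidal_functor ::
  "('o, 'm) catgroup \<Rightarrow> ('p, 'q) catgroup \<Rightarrow> ('o, 'm, 'p, 'q) catfunctor \<Rightarrow> bool" where
  "strict_monoidal_functor G H F \<longleftrightarrow>
     on_ob F \<in> hom (ob G) (ob H) \<and>
     on_ar F \<in> hom (ar G) (ar H) \<and>
     on_ob F \<one>\<^bsub>ob G\<^esub> = \<one>\<^bsub>ob H\<^esub> \<and>
     (\<forall>f\<in>carrier (ar G). src H (on_ar F f) = on_ob F (src G f) \<and>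
                         tgt H (on_ar F f) = on_ob F (tgt G f)) \<and>
     (\<forall>X\<in>carrier (ob G). on_ar F (ident G X) = ident H (on_ob F X)) \<and>
     (\<forall>f\<in>carrier (ar G). \<forall>g\<in>carrier (ar G). tgt G f = src G g \<longrightarrow>
        on_ar F (vcomp G f g) = vcomp H (on_ar F f) (on_ar F g))"

type_synonym ('o, 'm) catrep = "('o, 'm, nat mat, complex mat mat) catfunctor"

definition cat_representation :: "('o, 'm) catgroup \<Rightarrow> nat \<Rightarrow> ('o, 'm) catrep \<Rightarrow> bool" where
  "cat_representation G N R \<longleftrightarrow> strict_monoidal_functor G (GL2 N) R"

text \<open>For \<open>e \<in> E\<close> the source of \<open>R(e)\<close> is the identity matrix, and isomorphic 1-morphisms of
  2Vect are equal, so \<open>R(e)\<close> has invertible \<open>1 \<times> 1\<close> matrices on its diagonal and \<open>0 \<times> 0\<close>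
  matrices elsewhere. Hence \<open>R(e)\<close> is an element of \<open>(\<complex>\<^sup>*)\<^sup>N\<close>.\<close>

definition R_p :: "('o, 'm) catrep \<Rightarrow> 'm \<Rightarrow> complex vec" where
  "R_p R e = vec (dim_row (on_ar R e)) (\<lambda>i. (on_ar R e $$ (i, i)) $$ (0, 0))"

definition xi :: "('o, 'm) catrep \<Rightarrow> 'm \<Rightarrow> complex" where
  "xi R e = R_p R e $ 0"

record 'o intertwiner1 =
  mor :: "nat mat"
  cell :: "'o \<Rightarrow> complex mat mat"

definition one_intertwiner ::
  "('o, 'm) catgroup \<Rightarrow> nat \<Rightarrow> nat \<Rightarrow> ('o, 'm) catrep \<Rightarrow> ('o, 'm) catrep \<Rightarrow> 'o intertwiner1 \<Rightarrow> bool"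
where
  "one_intertwiner G N M R T h \<longleftrightarrow>
     mor h \<in> carrier_mat N M \<and>
     (\<forall>X\<in>carrier (ob G). cell h X \<in> iso2 (on_ob R X * mor h) (mor h * on_ob T X)) \<and>
     (\<forall>X\<in>carrier (ob G). \<forall>Y\<in>carrier (ob G).
        cell h (X \<otimes>\<^bsub>ob G\<^esub> Y)
          = vcomp2 (hcomp2 (id2 (on_ob R X)) (cell h Y)) (hcomp2 (cell h X) (id2 (on_ob T Y)))) \<and>
     cell h \<one>\<^bsub>ob G\<^esub> = id2 (mor h) \<and>
     (\<forall>f\<in>carrier (ar G).
        vcomp2 (hcomp2 (on_ar R f) (id2 (mor h))) (cell h (tgt G f))
          = vcomp2 (cell h (src G f)) (hcomp2 (id2 (mor h)) (on_ar T f)))"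

definition comp1 :: "'o intertwiner1 \<Rightarrow> 'o intertwiner1 \<Rightarrow> 'o intertwiner1" where
  "comp1 h k = \<lparr>mor = mor h * mor k,
     cell = (\<lambda>X. vcomp2 (hcomp2 (cell h X) (id2 (mor k))) (hcomp2 (id2 (mor h)) (cell k X)))\<rparr>"

definition two_intertwiner ::
  "('o, 'm) catgroup \<Rightarrow> ('o, 'm) catrep \<Rightarrow> ('o, 'm) catrep \<Rightarrow> 'o intertwiner1 \<Rightarrow> 'o intertwiner1
     \<Rightarrow> complex mat mat \<Rightarrow> bool"
where
  "two_intertwiner G R T h k \<phi> \<longleftrightarrow>
     \<phi> \<in> hom2 (mor h) (mor k) \<and>
     (\<forall>X\<in>carrier (ob G).
        vcomp2 (cell h X) (hcomp2 \<phi> (id2 (on_ob T X)))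
          = vcomp2 (hcomp2 (id2 (on_ob R X)) \<phi>) (cell k X))"

section \<open>Characters and ordinary representations\<close>

definition Cstar :: "complex monoid" where
  "Cstar = \<lparr>carrier = UNIV - {0}, mult = (*), one = 1\<rparr>"

definition invariant_character :: "('o, 'm) catgroup \<Rightarrow> ('m \<Rightarrow> complex) \<Rightarrow> bool" where
  "invariant_character G \<chi> \<longleftrightarrow>
     \<chi> \<in> hom (cm_E G) Cstar \<and>
     (\<forall>X\<in>carrier (ob G). \<forall>e\<in>carrier (cm_E G). \<chi> (cm_act G X e) = \<chi> e)"

definition GL :: "nat \<Rightarrow> complex mat monoid" where
  "GL n = units_of (ring_mat TYPE(complex) n ())"

definition ordinary_intertwiners ::
  "'o monoid \<Rightarrow> nat \<Rightarrow> ('o \<Rightarrow> complex mat) \<Rightarrow> nat \<Rightarrow> ('o \<Rightarrow> complex mat) \<Rightarrow> complex mat set" where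
  "ordinary_intertwiners K n \<rho> m \<sigma> =
     {B \<in> carrier_mat m n. \<forall>X\<in>carrier K. B * \<rho> X = \<sigma> X * B}"

definition tensor_rep :: "('o \<Rightarrow> complex mat) \<Rightarrow> ('o \<Rightarrow> complex mat) \<Rightarrow> 'o \<Rightarrow> complex mat" where
  "tensor_rep \<rho> \<sigma> X = kronecker (\<rho> X) (\<sigma> X)"

definition deg :: "'o intertwiner1 \<Rightarrow> nat" where
  "deg h = mor h $$ (0, 0)"

text \<open>In 2Vect vertical composition is the product of matrices in diagrammatic order, so an
  \<open>a \<times> b\<close> matrix \<open>A\<close> stands for the linear map \<open>v \<mapsto> v A\<close> from \<open>\<complex>\<^sup>a\<close> to \<open>\<complex>\<^sup>b\<close> on row vectors.
  The matrix of that map in the usual convention, where composition of maps is \<open>B \<circ> A\<close> and matrices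
  act on columns, is the transpose. The distinction matters: for dimension one the law
  for \<open>cell h (X \<circ> Y)\<close> reads \<open>cell h Y \<cdot> cell h X\<close>, which makes the linear maps, and not the
  row-vector matrices, multiplicative for the usual product of \<open>GL n\<close>.\<close>

definition lin :: "complex mat mat \<Rightarrow> complex mat" where
  "lin \<alpha> = transpose_mat (\<alpha> $$ (0, 0))"

definition rep_of :: "'o intertwiner1 \<Rightarrow> 'o \<Rightarrow> complex mat" where
  "rep_of h X = lin (cell h X)"

end

theory Submission
  imports Defs
begin

text \<open>In dimension one everything lives in \<open>1 \<times> 1\<close> matrices, so \<open>\<circ>\<close> becomes the Kronecker product
  and \<open>\<cdot>\<close> the matrix product. A morphism \<open>f : X \<rightarrow> Y\<close> factors as \<open>f = e \<circ> 1\<^sub>X\<close> with \<open>e \<in> E\<close>, and composition is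
  \<open>f \<cdot> g = f \<circ> 1\<^bsub>Y\<^esub>\<^sup>-\<^sup>1 \<circ> g\<close>; hence \<open>f \<mapsto> \<chi> e\<close> is multiplicative for both products exactly when \<open>\<chi>\<close> is an invariant
  character. The same factorization reduces naturality of a 1-intertwiner to morphisms in \<open>E\<close>, where it
  prescribes the scalar \<open>\<xi>\<^sub>R(e)\<^sup>-\<^sup>1\<xi>\<^sub>T(e)\<close> on \<open>\<partial>e\<close>.\<close>

section \<open>One-by-one matrices and Kronecker products\<close>

text \<open>One wrapper serves every level of dimension one: 1-morphisms are
  \<open>single n\<close>, 2-morphisms are \<open>single A\<close> for a complex matrix
  \<open>A\<close>, and the morphisms of \<open>GL2 1\<close> are
  \<open>single (single z)\<close>.\<close>

definition single :: "'a \<Rightarrow> 'a mat" where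
  "single x = mat 1 1 (\<lambda>_. x)"

lemma single_simps [simp]:
  "dim_row (single x) = 1" "dim_col (single x) = 1" "single x $$ (0, 0) = x"
  "single x \<in> carrier_mat 1 1" "single x \<in> carrier_mat (Suc 0) (Suc 0)"
  by (auto simp: single_def)

lemma single_eq_iff [simp]: "single x = single y \<longleftrightarrow> x = y"
  by (metis single_simps(3))

lemma carrier_mat_one_iff: "A \<in> carrier_mat 1 1 \<longleftrightarrow> A = single (A $$ (0, 0))"
proof
  assume "A \<in> carrier_mat 1 1"
  then show "A = single (A $$ (0, 0))" by (intro eq_matI) (auto simp: single_def)
next
  assume *: "A = single (A $$ (0, 0))"
  show "A \<in> carrier_mat 1 1" by (subst *) (rule single_simps)
qed

lemma one_mat_one: "1\<^sub>m 1 = single 1"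
  by (intro eq_matI) (auto simp: single_def)

lemma single_mult [simp]: "single a * single b = single (a * b :: 'a :: semiring_0)"
  by (intro eq_matI) (auto simp: single_def scalar_prod_def)

lemma transpose_mat_smult: "transpose_mat (c \<cdot>\<^sub>m A) = c \<cdot>\<^sub>m transpose_mat A"
  by (intro eq_matI) auto

section \<open>Kronecker products and the mixed-product rule\<close>

lemma kronecker_dim [simp]:
  "dim_row (kronecker A B) = dim_row A * dim_row B"
  "dim_col (kronecker A B) = dim_col A * dim_col B"
  by (auto simp: kronecker_def)

lemma kronecker_closed:
  "A \<in> carrier_mat a b \<Longrightarrow> B \<in> carrier_mat c d \<Longrightarrow> kronecker A B \<in> carrier_mat (a * c) (b * d)"
  by (intro carrier_matI) simp_all

lemma kronecker_single_left [simp]: "kronecker (single z) A = z \<cdot>\<^sub>m A"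
  by (intro eq_matI) (auto simp: kronecker_def)

lemma kronecker_single_right [simp]: "kronecker A (single z) = z \<cdot>\<^sub>m A"
  by (intro eq_matI) (auto simp: kronecker_def)

lemma kronecker_one_left [simp]: "kronecker (1\<^sub>m (Suc 0)) A = A"
  by (intro eq_matI) (auto simp: kronecker_def)

lemma kronecker_one_right [simp]: "kronecker A (1\<^sub>m (Suc 0)) = A"
  by (intro eq_matI) (auto simp: kronecker_def)

lemma kronecker_smult: "kronecker (a \<cdot>\<^sub>m A) (b \<cdot>\<^sub>m B) = (a * b) \<cdot>\<^sub>m kronecker A B"
proof (intro eq_matI)
  fix i j
  assume "i < dim_row ((a * b) \<cdot>\<^sub>m kronecker A B)" "j < dim_col ((a * b) \<cdot>\<^sub>m kronecker A B)"
  then have ij: "i < dim_row A * dim_row B" "j < dim_col A * dim_col B" by auto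
  \<comment> \<open>Matrices with no rows or no columns are allowed. An index inside the product
    shows that \<open>B\<close> is not one of them, so \<open>mod\<close> really yields an index of
    \<open>B\<close>.\<close>
  then have "0 < dim_row B" "0 < dim_col B" by (auto intro!: Nat.gr0I)
  with ij show "kronecker (a \<cdot>\<^sub>m A) (b \<cdot>\<^sub>m B) $$ (i, j) = ((a * b) \<cdot>\<^sub>m kronecker A B) $$ (i, j)"
    by (simp add: kronecker_def less_mult_imp_div_less)
qed auto

lemma kronecker_transpose:
  "transpose_mat (kronecker A B) = kronecker (transpose_mat A) (transpose_mat B)"
proof (intro eq_matI)
  fix i j
  assume "i < dim_row (kronecker (transpose_mat A) (transpose_mat B))"
    "j < dim_col (kronecker (transpose_mat A) (transpose_mat B))"
  then have ij: "i < dim_col A * dim_col B" "j < dim_row A * dim_row B" by auto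
  then have "0 < dim_row B" "0 < dim_col B" by (auto intro!: Nat.gr0I)
  with ij show "transpose_mat (kronecker A B) $$ (i, j)
      = kronecker (transpose_mat A) (transpose_mat B) $$ (i, j)"
    by (simp add: kronecker_def less_mult_imp_div_less)
qed auto

lemma kronecker_one [simp]: "kronecker (1\<^sub>m n) (1\<^sub>m m) = 1\<^sub>m (n * m)"
proof (intro eq_matI)
  fix i j
  assume "i < dim_row (1\<^sub>m (n * m) :: complex mat)" "j < dim_col (1\<^sub>m (n * m) :: complex mat)"
  then have ij: "i < n * m" "j < n * m" by auto
  then have "0 < m" by (auto intro!: Nat.gr0I)
  moreover have "i = j" if "i div m = j div m" "i mod m = j mod m"
    by (rule trans[OF div_mult_mod_eq[symmetric, of i m]]) (simp only: that div_mult_mod_eq)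
  ultimately show "kronecker (1\<^sub>m n) (1\<^sub>m m) $$ (i, j) = 1\<^sub>m (n * m) $$ (i, j)"
    using ij by (cases "i = j") (auto simp: kronecker_def less_mult_imp_div_less)
qed auto

text \<open>Division with remainder by \<open>m\<close> is a bijection between the numbers below
  \<open>n * m\<close> and pairs, with inverse sending \<open>(i, j)\<close> to
  \<open>i * m + j\<close>. It splits the contracted index in a product of Kronecker
  products.\<close>

lemma sum_div_mod:
  fixes f :: "nat \<Rightarrow> nat \<Rightarrow> 'a :: comm_monoid_add"
  shows "(\<Sum>k<n * m. f (k div m) (k mod m)) = (\<Sum>i<n. \<Sum>j<m. f i j)"
proof -
  have "(\<Sum>k<n * m. f (k div m) (k mod m)) = (\<Sum>(i, j)\<in>{..<n} \<times> {..<m}. f i j)"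
  proof (rule sum.reindex_bij_witness[where j = "\<lambda>k. (k div m, k mod m)" and i = "\<lambda>(i, j). i * m + j"])
    fix k assume "k \<in> {..<n * m}"
    then have k: "k < n * m" by simp
    then have "0 < m" by (auto intro!: Nat.gr0I)
    with k show "(k div m, k mod m) \<in> {..<n} \<times> {..<m}"
      by (auto simp: less_mult_imp_div_less)
  next
    fix p assume "p \<in> {..<n} \<times> {..<m}"
    then obtain i j where p: "p = (i, j)" "i < n" "j < m" by auto
    have "i * m + j < Suc i * m" using p by simp
    also have "\<dots> \<le> n * m" using p by (intro mult_le_mono1) simp
    finally show "(case p of (i, j) \<Rightarrow> i * m + j) \<in> {..<n * m}" using p by simp
  qed auto
  then show ?thesis by (simp add: sum.cartesian_product)
qed

text \<open>Mixed-product rule: after the contracted index is split into quotient and remainder, the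
  summand separates, and the double sum is the product of two ordinary contractions. In dimension
  one this is the compatibility of horizontal and vertical composition.\<close>

lemma kronecker_mult:
  assumes A: "A \<in> carrier_mat a b" and B: "B \<in> carrier_mat c d"
    and C: "C \<in> carrier_mat b p" and D: "D \<in> carrier_mat d q"
  shows "kronecker A B * kronecker C D = kronecker (A * C) (B * D)"
proof (intro eq_matI)
  fix i j
  assume "i < dim_row (kronecker (A * C) (B * D))" "j < dim_col (kronecker (A * C) (B * D))"
  then have ij: "i < a * c" "j < p * q" using assms by auto
  then have "0 < c" "0 < q" by (auto intro!: Nat.gr0I)
  with ij have *: "i div c < a" "i mod c < c" "j div q < p" "j mod q < q"
    by (auto simp: less_mult_imp_div_less)
  have "(kronecker A B * kronecker C D) $$ (i, j) =
    (\<Sum>k<b * d. A $$ (i div c, k div d) * B $$ (i mod c, k mod d)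
                 * (C $$ (k div d, j div q) * D $$ (k mod d, j mod q)))"
    using assms ij by (simp add: scalar_prod_def kronecker_def atLeast0LessThan)
  also have "\<dots> = (\<Sum>s<b. \<Sum>t<d. A $$ (i div c, s) * B $$ (i mod c, t)
                 * (C $$ (s, j div q) * D $$ (t, j mod q)))"
    by (rule sum_div_mod)
  also have "\<dots> = (\<Sum>s<b. A $$ (i div c, s) * C $$ (s, j div q))
                * (\<Sum>t<d. B $$ (i mod c, t) * D $$ (t, j mod q))"
    by (simp add: sum_product mult_ac)
  also have "\<dots> = kronecker (A * C) (B * D) $$ (i, j)"
    using assms ij * by (simp add: scalar_prod_def kronecker_def atLeast0LessThan)
  finally show "(kronecker A B * kronecker C D) $$ (i, j) = kronecker (A * C) (B * D) $$ (i, j)" .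
qed (use assms in auto)

section \<open>The one-dimensional part of 2Vect\<close>

lemma id2_single [simp]: "id2 (single n) = single (1\<^sub>m n)"
  by (intro eq_matI) (auto simp: id2_def single_def)

lemma src2_single [simp]: "src2 (single A) = single (dim_row A)"
  by (intro eq_matI) (auto simp: src2_def single_def)

lemma tgt2_single [simp]: "tgt2 (single A) = single (dim_col A)"
  by (intro eq_matI) (auto simp: tgt2_def single_def)

lemma vcomp2_single [simp]: "vcomp2 (single A) (single B) = single (A * B)"
  by (intro eq_matI) (auto simp: vcomp2_def single_def)

text \<open>The direct sum over the middle index has one summand, so only the tensor product
  remains.\<close>

lemma hcomp2_single [simp]: "hcomp2 (single A) (single B) = single (kronecker A B)"
proof -
  have "diag_block_mat [kronecker A B] = kronecker A B"
    by (intro eq_matI) (auto simp: Let_def)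
  then show ?thesis
    by (intro eq_matI) (auto simp: hcomp2_def single_def)
qed

lemma lin_single [simp]: "lin (single A) = transpose_mat A"
  by (simp add: lin_def)

lemma hom2_single: "\<alpha> \<in> hom2 (single a) (single b) \<longleftrightarrow> (\<exists>A\<in>carrier_mat a b. \<alpha> = single A)"
proof
  assume "\<alpha> \<in> hom2 (single a) (single b)"
  then have "\<alpha> \<in> carrier_mat 1 1" "\<alpha> $$ (0, 0) \<in> carrier_mat a b"
    by (auto simp: hom2_def)
  then show "\<exists>A\<in>carrier_mat a b. \<alpha> = single A"
    using carrier_mat_one_iff by blast
qed (auto simp: hom2_def)

section \<open>Invertible 2-morphisms and the categorical group of dimension one\<close>

lemma carrier_GL:
  "A \<in> carrier (GL n) \<longleftrightarrow>
     A \<in> carrier_mat n n \<and> (\<exists>B\<in>carrier_mat n n. A * B = 1\<^sub>m n \<and> B * A = 1\<^sub>m n)"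
  by (auto simp: GL_def units_of_def Units_def ring_mat_def)

lemma GL_I:
  assumes "A \<in> carrier_mat n n" "B \<in> carrier_mat n n" "A * B = 1\<^sub>m n" "B * A = 1\<^sub>m n"
  shows "A \<in> carrier (GL n)"
  unfolding carrier_GL by (intro conjI bexI[of _ B] assms)

lemma GL_E:
  assumes "A \<in> carrier (GL n)"
  obtains B where "A \<in> carrier_mat n n" "B \<in> carrier_mat n n" "A * B = 1\<^sub>m n" "B * A = 1\<^sub>m n"
  using assms unfolding carrier_GL by (elim conjE bexE)

lemma mult_GL [simp]: "A \<otimes>\<^bsub>GL n\<^esub> B = A * B"
  by (simp add: GL_def units_of_def ring_mat_def)

lemma one_GL [simp]: "\<one>\<^bsub>GL n\<^esub> = 1\<^sub>m n"
  by (simp add: GL_def units_of_def ring_mat_def)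

lemma group_GL: "group (GL n)"
proof -
  interpret ring "ring_mat TYPE(complex) n ()" by (rule ring_mat)
  show ?thesis unfolding GL_def by (rule units_group)
qed

lemma transpose_GL:
  assumes "A \<in> carrier (GL n)"
  shows "transpose_mat A \<in> carrier (GL n)"
proof -
  obtain B where B: "A \<in> carrier_mat n n" "B \<in> carrier_mat n n" "A * B = 1\<^sub>m n" "B * A = 1\<^sub>m n"
    by (rule GL_E[OF assms])
  have "transpose_mat A * transpose_mat B = 1\<^sub>m n" "transpose_mat B * transpose_mat A = 1\<^sub>m n"
    by (simp_all only: transpose_mult[OF B(1,2), symmetric] transpose_mult[OF B(2,1), symmetric]
        B transpose_one)
  then show ?thesis
    using B by (intro GL_I[of _ n "transpose_mat B"]) (simp_all only: transpose_carrier_mat)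
qed

lemma kronecker_GL:
  assumes A: "A \<in> carrier (GL n)" and B: "B \<in> carrier (GL m)"
  shows "kronecker A B \<in> carrier (GL (n * m))"
proof -
  obtain A' where A': "A \<in> carrier_mat n n" "A' \<in> carrier_mat n n" "A * A' = 1\<^sub>m n" "A' * A = 1\<^sub>m n"
    by (rule GL_E[OF A])
  obtain B' where B': "B \<in> carrier_mat m m" "B' \<in> carrier_mat m m" "B * B' = 1\<^sub>m m" "B' * B = 1\<^sub>m m"
    by (rule GL_E[OF B])
  show ?thesis
  proof (rule GL_I)
    show "kronecker A B * kronecker A' B' = 1\<^sub>m (n * m)"
      unfolding kronecker_mult[OF A'(1) B'(1) A'(2) B'(2)] A' B' by (rule kronecker_one)
    show "kronecker A' B' * kronecker A B = 1\<^sub>m (n * m)"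
      unfolding kronecker_mult[OF A'(2) B'(2) A'(1) B'(1)] A' B' by (rule kronecker_one)
  qed (rule kronecker_closed; fact)+
qed

lemma iso2_single: "\<alpha> \<in> iso2 (single n) (single n) \<longleftrightarrow> (\<exists>A\<in>carrier (GL n). \<alpha> = single A)"
proof
  assume "\<alpha> \<in> iso2 (single n) (single n)"
  then obtain \<beta> where *: "\<alpha> \<in> hom2 (single n) (single n)" "\<beta> \<in> hom2 (single n) (single n)"
      "vcomp2 \<alpha> \<beta> = id2 (single n)" "vcomp2 \<beta> \<alpha> = id2 (single n)"
    unfolding iso2_def by blast
  then obtain A B where AB: "A \<in> carrier_mat n n" "\<alpha> = single A" "B \<in> carrier_mat n n" "\<beta> = single B"
    unfolding hom2_single by blast
  from *(3,4) have "A * B = 1\<^sub>m n" "B * A = 1\<^sub>m n"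
    by (simp_all only: AB vcomp2_single id2_single single_eq_iff)
  with AB show "\<exists>A\<in>carrier (GL n). \<alpha> = single A"
    by (intro bexI[of _ A] GL_I)
next
  assume "\<exists>A\<in>carrier (GL n). \<alpha> = single A"
  then obtain A where A: "\<alpha> = single A" "A \<in> carrier (GL n)" by blast
  obtain B where B: "A \<in> carrier_mat n n" "B \<in> carrier_mat n n" "A * B = 1\<^sub>m n" "B * A = 1\<^sub>m n"
    by (rule GL_E[OF A(2)])
  have "single B \<in> hom2 (single n) (single n)" "\<alpha> \<in> hom2 (single n) (single n)"
    unfolding hom2_single using A B by blast+
  moreover have "vcomp2 \<alpha> (single B) = id2 (single n)" "vcomp2 (single B) \<alpha> = id2 (single n)"
    by (simp_all only: A B vcomp2_single id2_single)
  ultimately show "\<alpha> \<in> iso2 (single n) (single n)"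
    unfolding iso2_def by blast
qed

text \<open>This restates invertibility through the column-convention matrix
  \<open>lin \<alpha>\<close>, which may be used because transposition preserves invertibility. The
  equation for \<open>\<alpha>\<close> carries the information that \<open>lin\<close> discards,
  namely that \<open>\<alpha>\<close> has no entry besides \<open>(0, 0)\<close>.\<close>

lemma iso2_single_lin:
  "\<alpha> \<in> iso2 (single n) (single n) \<longleftrightarrow>
     \<alpha> = single (transpose_mat (lin \<alpha>)) \<and> lin \<alpha> \<in> carrier (GL n)"
proof
  assume "\<alpha> \<in> iso2 (single n) (single n)"
  then obtain A where "A \<in> carrier (GL n)" "\<alpha> = single A"
    unfolding iso2_single by blast
  then show "\<alpha> = single (transpose_mat (lin \<alpha>)) \<and> lin \<alpha> \<in> carrier (GL n)"
    by (simp add: transpose_GL)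
next
  assume "\<alpha> = single (transpose_mat (lin \<alpha>)) \<and> lin \<alpha> \<in> carrier (GL n)"
  then show "\<alpha> \<in> iso2 (single n) (single n)"
    unfolding iso2_single by (intro bexI[of _ "transpose_mat (lin \<alpha>)"] transpose_GL) blast+
qed

lemma carrier_GL_one: "A \<in> carrier (GL 1) \<longleftrightarrow> (\<exists>z. z \<noteq> 0 \<and> A = single z)"
proof
  assume "A \<in> carrier (GL 1)"
  then obtain B where "A \<in> carrier_mat 1 1" "B \<in> carrier_mat 1 1" and AB: "A * B = single 1"
    unfolding carrier_GL one_mat_one by blast
  then obtain z w where zw: "A = single z" "B = single w"
    using carrier_mat_one_iff by blast
  with AB have "z * w = 1" by simp
  with zw show "\<exists>z. z \<noteq> 0 \<and> A = single z" by force
next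
  assume "\<exists>z. z \<noteq> 0 \<and> A = single z"
  then obtain z where "z \<noteq> 0" "A = single z" by blast
  then show "A \<in> carrier (GL 1)"
    unfolding carrier_GL one_mat_one by (intro conjI bexI[of _ "single (inverse z)"]) simp_all
qed

text \<open>The entries are natural numbers, whose only multiplicative unit is 1. This is why a
  one-dimensional representation carries no data on objects.\<close>

lemma inv1mor_one: "inv1mor 1 = {single 1}"
proof (intro equalityI subsetI)
  fix a assume "a \<in> inv1mor 1"
  then obtain b where "a \<in> carrier_mat 1 1" "b \<in> carrier_mat 1 1" and ab: "a * b = single 1"
    unfolding inv1mor_def one_mat_one by blast
  then obtain x y where xy: "a = single x" "b = single y"
    using carrier_mat_one_iff by blast
  with ab show "a \<in> {single 1}" by simp
qed (auto simp: inv1mor_def one_mat_one[simplified] intro!: bexI[of _ "single 1"])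

lemma GL2_one_simps:
  "carrier (ob (GL2 1)) = {single 1}" "X \<otimes>\<^bsub>ob (GL2 1)\<^esub> Y = X * Y" "\<one>\<^bsub>ob (GL2 1)\<^esub> = single 1"
  "carrier (ar (GL2 1)) = {single (single z) |z. z \<noteq> 0}" "f \<otimes>\<^bsub>ar (GL2 1)\<^esub> g = hcomp2 f g"
  "src (GL2 1) = src2" "tgt (GL2 1) = tgt2" "ident (GL2 1) = id2" "vcomp (GL2 1) = vcomp2"
proof -
  show "carrier (ar (GL2 1)) = {single (single z) |z. z \<noteq> 0}"
    unfolding GL2_def inv1mor_one
    by (auto simp add: iso2_single Bex_def carrier_GL_one simp del: One_nat_def)
qed (simp_all add: GL2_def inv1mor_one one_mat_one del: One_nat_def)

lemmas [simp] = GL2_one_simps GL2_one_simps[unfolded One_nat_def]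

section \<open>Characters of the crossed module\<close>

lemma cm_E_simps [simp]:
  "e \<in> carrier (cm_E G) \<longleftrightarrow> e \<in> carrier (ar G) \<and> src G e = \<one>\<^bsub>ob G\<^esub>"
  "e \<otimes>\<^bsub>cm_E G\<^esub> e' = e \<otimes>\<^bsub>ar G\<^esub> e'" "\<one>\<^bsub>cm_E G\<^esub> = \<one>\<^bsub>ar G\<^esub>"
  by (auto simp: cm_E_def)

lemma Cstar_simps [simp]: "z \<in> carrier Cstar \<longleftrightarrow> z \<noteq> 0" "z \<otimes>\<^bsub>Cstar\<^esub> w = z * w"
  by (auto simp: Cstar_def)

lemma ordinary_intertwiners_mult:
  assumes B: "B \<in> ordinary_intertwiners K n \<rho> m \<sigma>" and C: "C \<in> ordinary_intertwiners K m \<sigma> l \<tau>"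
    and \<rho>: "\<And>X. X \<in> carrier K \<Longrightarrow> \<rho> X \<in> carrier_mat n n"
    and \<sigma>: "\<And>X. X \<in> carrier K \<Longrightarrow> \<sigma> X \<in> carrier_mat m m"
    and \<tau>: "\<And>X. X \<in> carrier K \<Longrightarrow> \<tau> X \<in> carrier_mat l l"
  shows "C * B \<in> ordinary_intertwiners K n \<rho> l \<tau>"
proof -
  have B': "B \<in> carrier_mat m n" and C': "C \<in> carrier_mat l m"
    using B C by (simp_all add: ordinary_intertwiners_def)
  have "C * B * \<rho> X = \<tau> X * (C * B)" if X: "X \<in> carrier K" for X
  proof -
    have "C * B * \<rho> X = C * (B * \<rho> X)" by (rule assoc_mult_mat[OF C' B' \<rho>[OF X]])
    also have "B * \<rho> X = \<sigma> X * B" using B X unfolding ordinary_intertwiners_def by blast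
    also have "C * (\<sigma> X * B) = C * \<sigma> X * B" by (rule assoc_mult_mat[symmetric, OF C' \<sigma>[OF X] B'])
    also have "C * \<sigma> X = \<tau> X * C" using C X unfolding ordinary_intertwiners_def by blast
    also have "\<tau> X * C * B = \<tau> X * (C * B)" by (rule assoc_mult_mat[OF \<tau>[OF X] C' B'])
    finally show ?thesis .
  qed
  with mult_carrier_mat[OF C' B'] show ?thesis
    unfolding ordinary_intertwiners_def by blast
qed

text \<open>By the mixed-product rule the required relation splits into the intertwining relations
  of the two factors.\<close>

lemma ordinary_intertwiners_kronecker:
  assumes B: "B \<in> ordinary_intertwiners K n \<rho> m \<sigma>" and C: "C \<in> ordinary_intertwiners K p \<tau> q \<upsilon>"
    and \<rho>: "\<And>X. X \<in> carrier K \<Longrightarrow> \<rho> X \<in> carrier_mat n n"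
    and \<sigma>: "\<And>X. X \<in> carrier K \<Longrightarrow> \<sigma> X \<in> carrier_mat m m"
    and \<tau>: "\<And>X. X \<in> carrier K \<Longrightarrow> \<tau> X \<in> carrier_mat p p"
    and \<upsilon>: "\<And>X. X \<in> carrier K \<Longrightarrow> \<upsilon> X \<in> carrier_mat q q"
  shows "kronecker B C \<in> ordinary_intertwiners K (n * p) (tensor_rep \<rho> \<tau>) (m * q) (tensor_rep \<sigma> \<upsilon>)"
proof -
  have B': "B \<in> carrier_mat m n" and C': "C \<in> carrier_mat q p"
    using B C by (simp_all add: ordinary_intertwiners_def)
  have "kronecker B C * tensor_rep \<rho> \<tau> X = tensor_rep \<sigma> \<upsilon> X * kronecker B C"
    if X: "X \<in> carrier K" for X
  proof -
    have "B * \<rho> X = \<sigma> X * B" "C * \<tau> X = \<upsilon> X * C"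
      using B C X unfolding ordinary_intertwiners_def by blast+
    then show ?thesis
      unfolding tensor_rep_def kronecker_mult[OF B' C' \<rho>[OF X] \<tau>[OF X]]
        kronecker_mult[OF \<sigma>[OF X] \<upsilon>[OF X] B' C'] by (simp only:)
  qed
  with kronecker_closed[OF B' C'] show ?thesis
    unfolding ordinary_intertwiners_def by blast
qed

section \<open>Splitting a morphism into an element of \<open>E\<close> and an identity\<close>

context categorical_group
begin

interpretation src: group_hom "ar G" "ob G" "src G" by unfold_locales (rule src_hom)
interpretation tgt: group_hom "ar G" "ob G" "tgt G" by unfold_locales (rule tgt_hom)
interpretation ident: group_hom "ob G" "ar G" "ident G" by unfold_locales (rule ident_hom)

lemmas [simp] = src_ident tgt_ident

text \<open>The left factor in the decomposition of \<open>f\<close> as an element of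
  \<open>E\<close> times the identity of its source. It retracts the group \<open>ar G\<close> onto
  \<open>E\<close>.\<close>

definition to_E :: "'m \<Rightarrow> 'm" where
  "to_E f = f \<otimes>\<^bsub>ar G\<^esub> ident G (inv\<^bsub>ob G\<^esub> (src G f))"

lemma to_E_closed: "f \<in> carrier (ar G) \<Longrightarrow> to_E f \<in> carrier (cm_E G)"
  by (simp add: to_E_def)

lemma to_E_E: "e \<in> carrier (cm_E G) \<Longrightarrow> to_E e = e"
  by (simp add: to_E_def)

lemma to_E_ident: "X \<in> carrier (ob G) \<Longrightarrow> to_E (ident G X) = \<one>\<^bsub>ar G\<^esub>"
  by (simp add: to_E_def)

text \<open>Apply the homomorphism \<open>tgt G\<close> to the decomposition of \<open>f\<close>. A
  representation of objects then takes values at target and source that differ by its value on a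
  boundary.\<close>

lemma tgt_eq_to_E: "f \<in> carrier (ar G) \<Longrightarrow> tgt G f = tgt G (to_E f) \<otimes>\<^bsub>ob G\<^esub> src G f"
  by (simp add: to_E_def ob.m_assoc)

lemma cm_act_closed:
  "X \<in> carrier (ob G) \<Longrightarrow> e \<in> carrier (cm_E G) \<Longrightarrow> cm_act G X e \<in> carrier (cm_E G)"
  by (simp add: cm_act_def)

text \<open>The multiplication rule of the semidirect product of \<open>E\<close> and the group of
  objects. On the right, the identity on the source of \<open>f\<close> from the action cancels the
  inverse identity at the end of \<open>to_E f\<close>.\<close>

lemma to_E_mult:
  assumes "f \<in> carrier (ar G)" "g \<in> carrier (ar G)"
  shows "to_E (f \<otimes>\<^bsub>ar G\<^esub> g) = to_E f \<otimes>\<^bsub>ar G\<^esub> cm_act G (src G f) (to_E g)"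
proof -
  have "f \<otimes>\<^bsub>ar G\<^esub> inv\<^bsub>ar G\<^esub> ident G (src G f) \<otimes>\<^bsub>ar G\<^esub> ident G (src G f) = f"
    using assms by (simp add: ar.m_assoc)
  with assms show ?thesis
    by (simp add: to_E_def cm_act_def ob.inv_mult_group ar.inv_mult_group flip: ar.m_assoc)
qed

text \<open>Write \<open>f\<close> as \<open>f\<close> followed by the identity of its target
  \<open>Y\<close>, and \<open>g\<close> as the product of that identity with a morphism
  \<open>?g\<close> starting at the unit object. The interchange law then trades the composition for
  a product, as in the Eckmann-Hilton argument.\<close>

lemma vcomp_eq:
  assumes f: "f \<in> carrier (ar G)" and g: "g \<in> carrier (ar G)" and fg: "tgt G f = src G g"
  shows "vcomp G f g = f \<otimes>\<^bsub>ar G\<^esub> (ident G (inv\<^bsub>ob G\<^esub> (tgt G f)) \<otimes>\<^bsub>ar G\<^esub> g)"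
proof -
  let ?Y = "tgt G f" and ?g = "ident G (inv\<^bsub>ob G\<^esub> (tgt G f)) \<otimes>\<^bsub>ar G\<^esub> g"
  have *: "?g \<in> carrier (ar G)" "src G ?g = \<one>\<^bsub>ob G\<^esub>"
    using f g fg by simp_all
  have "vcomp G f (ident G ?Y) \<otimes>\<^bsub>ar G\<^esub> vcomp G (ident G \<one>\<^bsub>ob G\<^esub>) ?g
      = vcomp G (f \<otimes>\<^bsub>ar G\<^esub> ident G \<one>\<^bsub>ob G\<^esub>) (ident G ?Y \<otimes>\<^bsub>ar G\<^esub> ?g)"
    using f * by (intro interchange) simp_all
  moreover have "ident G ?Y \<otimes>\<^bsub>ar G\<^esub> ?g = g"
    using f g by (simp flip: ar.m_assoc)
  moreover have "vcomp G (ident G \<one>\<^bsub>ob G\<^esub>) ?g = ?g"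
    using ident_vcomp[OF *(1)] unfolding *(2) .
  ultimately show ?thesis
    using f vcomp_ident[OF f] by simp
qed

text \<open>\<open>E\<close> is closed under products and under the action, so being an invariant
  character depends only on values on \<open>E\<close>. Elsewhere the functions may differ, as
  \<open>xi R\<close> and a prescribed character do.\<close>

lemma invariant_character_cong:
  assumes "\<And>e. e \<in> carrier (cm_E G) \<Longrightarrow> \<chi> e = \<psi> e"
  shows "invariant_character G \<chi> \<longleftrightarrow> invariant_character G \<psi>"
proof -
  have "\<chi> (e \<otimes>\<^bsub>ar G\<^esub> e') = \<psi> (e \<otimes>\<^bsub>ar G\<^esub> e')"
    if "e \<in> carrier (cm_E G)" "e' \<in> carrier (cm_E G)" for e e'
    using that by (intro assms) simp
  then show ?thesis
    using assms cm_act_closed by (auto simp: invariant_character_def hom_def Pi_iff)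
qed

context
  fixes \<chi> assumes \<chi>: "invariant_character G \<chi>"
begin

lemma character_nonzero: "e \<in> carrier (cm_E G) \<Longrightarrow> \<chi> e \<noteq> 0"
  using \<chi> by (auto simp: invariant_character_def hom_def Pi_iff)

lemma character_mult:
  "e \<in> carrier (cm_E G) \<Longrightarrow> e' \<in> carrier (cm_E G) \<Longrightarrow> \<chi> (e \<otimes>\<^bsub>ar G\<^esub> e') = \<chi> e * \<chi> e'"
  using \<chi> by (auto simp: invariant_character_def hom_def)

lemma character_act:
  "X \<in> carrier (ob G) \<Longrightarrow> e \<in> carrier (cm_E G) \<Longrightarrow> \<chi> (cm_act G X e) = \<chi> e"
  using \<chi> by (auto simp: invariant_character_def)

lemma character_one: "\<chi> \<one>\<^bsub>ar G\<^esub> = 1"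
  using character_mult[of "\<one>\<^bsub>ar G\<^esub>" "\<one>\<^bsub>ar G\<^esub>"] character_nonzero[of "\<one>\<^bsub>ar G\<^esub>"] by simp

text \<open>Invariance of \<open>\<chi>\<close> absorbs the action in \<open>to_E_mult\<close>, so
  the composite with \<open>to_E\<close> is multiplicative on all morphisms.\<close>

lemma character_to_E_mult:
  "f \<in> carrier (ar G) \<Longrightarrow> g \<in> carrier (ar G) \<Longrightarrow>
     \<chi> (to_E (f \<otimes>\<^bsub>ar G\<^esub> g)) = \<chi> (to_E f) * \<chi> (to_E g)"
  by (simp only: to_E_mult character_mult character_act to_E_closed cm_act_closed src_closed)

text \<open>Composition is a product with an extra identity factor, and identities have trivial
  \<open>E\<close>-part.\<close>

lemma character_to_E_vcomp:
  assumes "f \<in> carrier (ar G)" "g \<in> carrier (ar G)" "tgt G f = src G g"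
  shows "\<chi> (to_E (vcomp G f g)) = \<chi> (to_E f) * \<chi> (to_E g)"
  using assms
  by (simp only: vcomp_eq character_to_E_mult ar.m_closed ident_closed ob.inv_closed src_closed
      to_E_ident character_one mult_1_left)

end

section \<open>One-dimensional representations\<close>

lemma xi_single: "on_ar R e = single (single z) \<Longrightarrow> xi R e = z"
  by (simp add: xi_def R_p_def)

text \<open>The working form of (a). Forwards, \<open>GL2 1\<close> has one object and commuting
  scalars as morphisms, so conjugation by identities is invisible and invariance follows. Backwards,
  both compositions in \<open>GL2 1\<close> multiply scalars, which matches the multiplicativity of
  a character composed with \<open>to_E\<close>.\<close>

lemma cat_representation_iff:
  "cat_representation G 1 R \<longleftrightarrow>
     (\<forall>X\<in>carrier (ob G). on_ob R X = single 1) \<and> invariant_character G (xi R) \<and>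
     (\<forall>f\<in>carrier (ar G). on_ar R f = single (single (xi R (to_E f))))"
  (is "?L \<longleftrightarrow> ?R")
proof
  assume L: ?L
  then have ob: "on_ob R X = single 1" if "X \<in> carrier (ob G)" for X
    using that by (auto simp: cat_representation_def strict_monoidal_functor_def hom_def Pi_iff)
  \<comment> \<open>Here \<open>xi R\<close> is read on all morphisms, not only on \<open>E\<close>;
    only at the end is it compared with its value at \<open>to_E f\<close>.\<close>
  have ar: "on_ar R f = single (single (xi R f)) \<and> xi R f \<noteq> 0" if "f \<in> carrier (ar G)" for f
  proof -
    have "on_ar R f \<in> carrier (ar (GL2 1))"
      using L that by (auto simp: cat_representation_def strict_monoidal_functor_def hom_def Pi_iff)
    then show ?thesis by (auto simp: xi_single)
  qed
  have mult: "xi R (f \<otimes>\<^bsub>ar G\<^esub> g) = xi R f * xi R g"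
    if "f \<in> carrier (ar G)" "g \<in> carrier (ar G)" for f g
  proof (rule xi_single)
    have "on_ar R (f \<otimes>\<^bsub>ar G\<^esub> g) = hcomp2 (on_ar R f) (on_ar R g)"
      using L that by (auto simp: cat_representation_def strict_monoidal_functor_def hom_def)
    also have "\<dots> = hcomp2 (single (single (xi R f))) (single (single (xi R g)))"
      using ar that by metis
    also have "\<dots> = single (single (xi R f * xi R g))"
      unfolding hcomp2_single kronecker_single_left single_eq_iff
      by (intro eq_matI) (auto simp: single_def)
    finally show "on_ar R (f \<otimes>\<^bsub>ar G\<^esub> g) = single (single (xi R f * xi R g))" .
  qed
  have ident: "xi R (ident G X) = 1" if "X \<in> carrier (ob G)" for X
  proof (rule xi_single)
    have "on_ar R (ident G X) = id2 (on_ob R X)"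
      using L that by (simp add: cat_representation_def strict_monoidal_functor_def)
    then show "on_ar R (ident G X) = single (single 1)"
      using ob[OF that] by (simp only: id2_single one_mat_one)
  qed
  have "invariant_character G (xi R)"
    unfolding invariant_character_def
    by (auto simp: hom_def Pi_iff ar mult ident cm_act_def simp del: ident.hom_inv)
  \<comment> \<open>The two arguments differ by an identity, on which \<open>xi R\<close> is
    1.\<close>
  moreover have "xi R (to_E f) = xi R f" if "f \<in> carrier (ar G)" for f
    using that by (simp add: to_E_def mult ident del: ident.hom_inv)
  ultimately show ?R
    using ob ar by simp
next
  assume R: ?R
  then have \<chi>: "invariant_character G (xi R)" by blast
  have nonzero: "xi R (to_E f) \<noteq> 0" if "f \<in> carrier (ar G)" for f
    using character_nonzero[OF \<chi> to_E_closed[OF that]] .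
  have ss: "z \<cdot>\<^sub>m single w = single (z * w)" for z w :: complex
    by (intro eq_matI) (auto simp: single_def)
  have one: "xi R \<one>\<^bsub>ar G\<^esub> = 1"
    by (rule character_one[OF \<chi>])
  show ?L
    unfolding cat_representation_def strict_monoidal_functor_def hom_def
    using R nonzero
    by (auto simp: Pi_iff character_to_E_mult[OF \<chi>] character_to_E_vcomp[OF \<chi>] to_E_ident one ss
        src_closed tgt_closed ident_closed vcomp_closed one_mat_one[simplified])
qed

lemma cat_representation_exists:
  assumes "invariant_character G \<chi>"
  shows "\<exists>R. cat_representation G 1 R \<and> (\<forall>e\<in>carrier (cm_E G). xi R e = \<chi> e)"
proof -
  \<comment> \<open>Since \<open>\<chi>\<close> is controlled only on \<open>E\<close>, it is
    evaluated at the \<open>E\<close>-part of a morphism; \<open>to_E\<close> fixes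
    \<open>E\<close>, so \<open>xi\<close> returns \<open>\<chi>\<close> there.\<close>
  define R :: "('o, 'm) catrep" where
    "R = \<lparr>on_ob = \<lambda>_. single 1, on_ar = \<lambda>f. single (single (\<chi> (to_E f)))\<rparr>"
  have xi: "xi R e = \<chi> e" if "e \<in> carrier (cm_E G)" for e
    using to_E_E[OF that] by (simp add: R_def xi_single)
  moreover have "xi R (to_E f) = \<chi> (to_E f)" if "f \<in> carrier (ar G)" for f
    using xi to_E_closed[OF that] .
  moreover have "invariant_character G (xi R)"
    using assms invariant_character_cong xi by blast
  ultimately show ?thesis
    unfolding cat_representation_iff by (intro exI[of _ R] conjI ballI) (auto simp: R_def)
qed


section \<open>Intertwiners in dimension one\<close>

text \<open>The working form of (b), with the zero intertwiner included as degree 0. Horizontal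
  composition with an identity on \<open>single 1\<close> changes nothing, so the product law
  becomes a reversed matrix product, which transposition turns into the homomorphism law. Naturality
  becomes the scalar condition on boundaries.\<close>

lemma one_intertwiner_iff:
  assumes R: "cat_representation G 1 R" and T: "cat_representation G 1 T"
  shows "one_intertwiner G 1 1 R T h \<longleftrightarrow>
     mor h = single (deg h) \<and> (\<forall>X\<in>carrier (ob G). cell h X = single (transpose_mat (rep_of h X))) \<and>
     rep_of h \<in> hom (ob G) (GL (deg h)) \<and>
     (\<forall>e\<in>carrier (cm_E G). rep_of h (cm_bdry G e) = (inverse (xi R e) * xi T e) \<cdot>\<^sub>m 1\<^sub>m (deg h))"
  (is "?L \<longleftrightarrow> ?R")
proof -
  define n where "n = deg h"
  define \<rho> where "\<rho> = rep_of h"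
  define \<chi> \<psi> where "\<chi> = xi R" and "\<psi> = xi T"
  have \<chi>: "invariant_character G \<chi>" and \<psi>: "invariant_character G \<psi>"
    using R T unfolding cat_representation_iff \<chi>_def \<psi>_def by blast+
  have obR: "on_ob R X = single 1" and obT: "on_ob T X = single 1" if "X \<in> carrier (ob G)" for X
    using R T that unfolding cat_representation_iff by blast+
  have arR: "on_ar R f = single (single (\<chi> (to_E f)))" and arT: "on_ar T f = single (single (\<psi> (to_E f)))"
    if "f \<in> carrier (ar G)" for f
    using R T that unfolding cat_representation_iff \<chi>_def \<psi>_def by blast+
  \<comment> \<open>Both representations are trivial on objects, so source and target of the cell
    coincide and the cell is an automorphism.\<close>
  have iso: "cell h X \<in> iso2 (on_ob R X * single n) (single n * on_ob T X) \<longleftrightarrow>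
      cell h X = single (transpose_mat (\<rho> X)) \<and> \<rho> X \<in> carrier (GL n)" if "X \<in> carrier (ob G)" for X
    using that iso2_single_lin[of "cell h X" n]
    by (simp only: obR obT single_mult mult_1_left mult_1_right \<rho>_def rep_of_def)
  show ?thesis
  proof
    assume L: ?L
    then have "mor h \<in> carrier_mat 1 1" unfolding one_intertwiner_def by blast
    then have mor: "mor h = single n"
      unfolding carrier_mat_one_iff n_def deg_def .
    have cell: "cell h X = single (transpose_mat (\<rho> X))" and GL: "\<rho> X \<in> carrier (GL n)"
      if "X \<in> carrier (ob G)" for X
      using L iso[OF that] that unfolding one_intertwiner_def mor by blast+
    have carr: "\<rho> X \<in> carrier_mat n n" if "X \<in> carrier (ob G)" for X
      using GL[OF that] unfolding carrier_GL by blast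
    have mult: "\<rho> (X \<otimes>\<^bsub>ob G\<^esub> Y) = \<rho> X * \<rho> Y" if X: "X \<in> carrier (ob G)" and Y: "Y \<in> carrier (ob G)" for X Y
    proof -
      have "cell h (X \<otimes>\<^bsub>ob G\<^esub> Y)
          = vcomp2 (hcomp2 (id2 (on_ob R X)) (cell h Y)) (hcomp2 (cell h X) (id2 (on_ob T Y)))"
        using L X Y unfolding one_intertwiner_def by blast
      then have "transpose_mat (\<rho> (X \<otimes>\<^bsub>ob G\<^esub> Y)) = transpose_mat (\<rho> Y) * transpose_mat (\<rho> X)"
        using X Y by (simp add: cell obR obT)
      also have "\<dots> = transpose_mat (\<rho> X * \<rho> Y)"
        by (rule transpose_mult[symmetric, OF carr[OF X] carr[OF Y]])
      finally show ?thesis by simp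
    qed
    have bdry: "\<rho> (cm_bdry G e) = (inverse (\<chi> e) * \<psi> e) \<cdot>\<^sub>m 1\<^sub>m n" if e: "e \<in> carrier (cm_E G)" for e
    proof -
      have X: "tgt G e \<in> carrier (ob G)" "e \<in> carrier (ar G)" "src G e = \<one>\<^bsub>ob G\<^esub>" using e by simp_all
      have "vcomp2 (hcomp2 (on_ar R e) (id2 (mor h))) (cell h (tgt G e))
          = vcomp2 (cell h (src G e)) (hcomp2 (id2 (mor h)) (on_ar T e))"
        using L X unfolding one_intertwiner_def by blast
      \<comment> \<open>A morphism in \<open>E\<close> starts at the unit object, so one of the two
        cells in its naturality square is an identity.\<close>
      moreover have "cell h \<one>\<^bsub>ob G\<^esub> = single (1\<^sub>m n)"
        using L unfolding one_intertwiner_def mor by simp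
      ultimately have "(\<chi> e \<cdot>\<^sub>m 1\<^sub>m n) * transpose_mat (\<rho> (tgt G e)) = 1\<^sub>m n * (\<psi> e \<cdot>\<^sub>m 1\<^sub>m n)"
        by (simp only: X arR arT mor to_E_E[OF e] id2_single hcomp2_single vcomp2_single single_eq_iff
            cell kronecker_single_left kronecker_single_right)
      then have eq: "\<chi> e \<cdot>\<^sub>m transpose_mat (\<rho> (tgt G e)) = \<psi> e \<cdot>\<^sub>m 1\<^sub>m n"
        using carr[OF X(1)] by (simp add: mult_smult_assoc_mat[of _ n n _ n])
      \<comment> \<open>Division by the nonzero scalar \<open>\<chi> e\<close> is done entry by
        entry. The transpose swaps the indices, which does not affect a scalar matrix.\<close>
      have "\<rho> (tgt G e) $$ (i, j) = ((inverse (\<chi> e) * \<psi> e) \<cdot>\<^sub>m 1\<^sub>m n) $$ (i, j)" if "i < n" "j < n" for i j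
      proof -
        have "\<chi> e * \<rho> (tgt G e) $$ (i, j) = (\<chi> e \<cdot>\<^sub>m transpose_mat (\<rho> (tgt G e))) $$ (j, i)"
          using that carr[OF X(1)] by simp
        also have "\<dots> = \<psi> e * (if i = j then 1 else 0)"
          unfolding eq using that by simp
        finally show ?thesis
          using that character_nonzero[OF \<chi> e] by (simp add: field_simps split: if_splits)
      qed
      then show ?thesis
        unfolding cm_bdry_def using carr[OF X(1)] by (intro eq_matI) auto
    qed
    show ?R
      unfolding hom_def n_def[symmetric] \<rho>_def[symmetric] \<chi>_def[symmetric] \<psi>_def[symmetric]
      using mor cell GL mult bdry by simp
  next
    assume ?R
    then have mor: "mor h = single n"
      and cell: "\<And>X. X \<in> carrier (ob G) \<Longrightarrow> cell h X = single (transpose_mat (\<rho> X))"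
      and hom: "\<rho> \<in> hom (ob G) (GL n)"
      and bdry: "\<And>e. e \<in> carrier (cm_E G) \<Longrightarrow> \<rho> (tgt G e) = (inverse (\<chi> e) * \<psi> e) \<cdot>\<^sub>m 1\<^sub>m n"
      unfolding cm_bdry_def n_def \<rho>_def \<chi>_def \<psi>_def by blast+
    interpret GL: group "GL n" by (rule group_GL)
    interpret \<rho>: group_hom "ob G" "GL n" \<rho> by unfold_locales (rule hom)
    have GL: "\<rho> X \<in> carrier (GL n)" and mult: "Y \<in> carrier (ob G) \<Longrightarrow> \<rho> (X \<otimes>\<^bsub>ob G\<^esub> Y) = \<rho> X * \<rho> Y"
      if "X \<in> carrier (ob G)" for X Y
      using \<rho>.hom_closed[OF that] \<rho>.hom_mult[OF that] by simp_all
    have carr: "\<rho> X \<in> carrier_mat n n" if "X \<in> carrier (ob G)" for X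
      using GL[OF that] unfolding carrier_GL by blast
    have tr: "transpose_mat (\<rho> Y) * transpose_mat (\<rho> X) = transpose_mat (\<rho> (X \<otimes>\<^bsub>ob G\<^esub> Y))"
      if X: "X \<in> carrier (ob G)" and Y: "Y \<in> carrier (ob G)" for X Y
      unfolding mult[OF X Y] by (rule transpose_mult[symmetric, OF carr[OF X] carr[OF Y]])
    have nat: "vcomp2 (hcomp2 (on_ar R f) (id2 (mor h))) (cell h (tgt G f))
          = vcomp2 (cell h (src G f)) (hcomp2 (id2 (mor h)) (on_ar T f))"
      if f: "f \<in> carrier (ar G)" for f
    proof -
      have X: "src G f \<in> carrier (ob G)" "tgt G f \<in> carrier (ob G)" "tgt G (to_E f) \<in> carrier (ob G)"
        using f to_E_closed[OF f] by simp_all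
      \<comment> \<open>Naturality at an arbitrary \<open>f\<close> is recovered from its
        \<open>E\<close>-part: the boundary contributes a scalar and the homomorphism law supplies
        the rest.\<close>
      have "\<rho> (tgt G f) = \<rho> (tgt G (to_E f)) * \<rho> (src G f)"
        by (subst tgt_eq_to_E[OF f]) (rule mult[OF X(3,1)])
      also have "\<dots> = (inverse (\<chi> (to_E f)) * \<psi> (to_E f)) \<cdot>\<^sub>m \<rho> (src G f)"
        unfolding bdry[OF to_E_closed[OF f]]
        using carr[OF X(1)] by (simp add: mult_smult_assoc_mat[of _ n n _ n])
      finally have "\<chi> (to_E f) \<cdot>\<^sub>m \<rho> (tgt G f) = \<psi> (to_E f) \<cdot>\<^sub>m \<rho> (src G f)"
        using character_nonzero[OF \<chi> to_E_closed[OF f]] carr[OF X(1)] by (auto intro!: eq_matI)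
      then have *: "\<chi> (to_E f) \<cdot>\<^sub>m transpose_mat (\<rho> (tgt G f)) = \<psi> (to_E f) \<cdot>\<^sub>m transpose_mat (\<rho> (src G f))"
        by (metis transpose_mat_smult)
      have "(\<chi> (to_E f) \<cdot>\<^sub>m 1\<^sub>m n) * transpose_mat (\<rho> (tgt G f))
          = transpose_mat (\<rho> (src G f)) * (\<psi> (to_E f) \<cdot>\<^sub>m 1\<^sub>m n)"
        using carr[OF X(1)] carr[OF X(2)] *
        by (simp add: mult_smult_assoc_mat[of _ n n _ n] mult_smult_distrib[of _ n n _ n])
      then show ?thesis
        by (simp only: X f arR arT mor id2_single hcomp2_single vcomp2_single single_eq_iff
            cell kronecker_single_left kronecker_single_right)
    qed
    have "cell h \<one>\<^bsub>ob G\<^esub> = id2 (mor h)"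
      using \<rho>.hom_one by (simp add: cell mor)
    moreover have "cell h (X \<otimes>\<^bsub>ob G\<^esub> Y)
          = vcomp2 (hcomp2 (id2 (on_ob R X)) (cell h Y)) (hcomp2 (cell h X) (id2 (on_ob T Y)))"
      if "X \<in> carrier (ob G)" "Y \<in> carrier (ob G)" for X Y
      using that by (simp add: cell obR obT tr)
    moreover have "cell h X \<in> iso2 (on_ob R X * mor h) (mor h * on_ob T X)" if "X \<in> carrier (ob G)" for X
      using iso[OF that] cell[OF that] GL[OF that] unfolding mor by blast
    moreover have "mor h \<in> carrier_mat 1 1" unfolding mor by (rule single_simps)
    ultimately show ?L
      unfolding one_intertwiner_def using nat by blast
  qed
qed

lemma one_intertwiner_carrier:
  assumes "cat_representation G 1 R" "cat_representation G 1 T" "one_intertwiner G 1 1 R T h"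
    "X \<in> carrier (ob G)"
  shows "rep_of h X \<in> carrier_mat (deg h) (deg h)"
  using assms(3,4) unfolding one_intertwiner_iff[OF assms(1,2)] hom_def Pi_iff carrier_GL by blast

section \<open>Composition of 1-intertwiners as tensor product\<close>

lemma comp1_cell:
  assumes "mor h = single n" "mor k = single m" "cell h X = single (transpose_mat A)"
    "cell k X = single (transpose_mat B)" "A \<in> carrier_mat n n" "B \<in> carrier_mat m m"
  shows "cell (comp1 h k) X = single (transpose_mat (kronecker A B))"
proof -
  have "cell (comp1 h k) X
      = single (kronecker (transpose_mat A) (1\<^sub>m m) * kronecker (1\<^sub>m n) (transpose_mat B))"
    by (simp add: comp1_def assms(1-4))
  also have "\<dots> = single (kronecker (transpose_mat A * 1\<^sub>m n) (1\<^sub>m m * transpose_mat B))"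
    using assms(5,6) by (subst kronecker_mult[of _ n n _ m m]) auto
  also have "\<dots> = single (transpose_mat (kronecker A B))"
    using assms(5,6) by (simp add: kronecker_transpose)
  finally show ?thesis .
qed

text \<open>The composite is checked through the characterization instead of the axioms. The
  homomorphism law is the mixed-product rule, and in the scalar condition the character of the
  middle representation cancels.\<close>

lemma comp1_intertwiner:
  assumes R: "cat_representation G 1 R" and T: "cat_representation G 1 T"
    and U: "cat_representation G 1 U"
    and h: "one_intertwiner G 1 1 R T h" and k: "one_intertwiner G 1 1 T U k"
  shows "one_intertwiner G 1 1 R U (comp1 h k)"
    and "deg (comp1 h k) = deg h * deg k"
    and "X \<in> carrier (ob G) \<Longrightarrow> rep_of (comp1 h k) X = tensor_rep (rep_of h) (rep_of k) X"
proof -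
  note h' = h[unfolded one_intertwiner_iff[OF R T]] and k' = k[unfolded one_intertwiner_iff[OF T U]]
  note hc = one_intertwiner_carrier[OF R T h] and kc = one_intertwiner_carrier[OF T U k]
  have mor: "mor (comp1 h k) = single (deg h * deg k)"
    using h' k' unfolding comp1_def by (metis intertwiner1.select_convs(1) single_mult)
  then show deg: "deg (comp1 h k) = deg h * deg k"
    unfolding deg_def[of "comp1 h k"] by simp
  have cell: "cell (comp1 h k) X = single (transpose_mat (kronecker (rep_of h X) (rep_of k X)))"
    if "X \<in> carrier (ob G)" for X
    using h' k' hc kc that by (intro comp1_cell) blast+
  then show rep: "rep_of (comp1 h k) X = tensor_rep (rep_of h) (rep_of k) X"
    if "X \<in> carrier (ob G)" for X
    using that unfolding rep_of_def[of "comp1 h k"] tensor_rep_def by simp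
  have "rep_of (comp1 h k) \<in> hom (ob G) (GL (deg h * deg k))"
  proof (rule homI)
    fix X assume X: "X \<in> carrier (ob G)"
    then show "rep_of (comp1 h k) X \<in> carrier (GL (deg h * deg k))"
      using h' k' unfolding rep[OF X] tensor_rep_def hom_def Pi_iff by (blast intro: kronecker_GL)
    fix Y assume Y: "Y \<in> carrier (ob G)"
    have "rep_of h (X \<otimes>\<^bsub>ob G\<^esub> Y) = rep_of h X * rep_of h Y" "rep_of k (X \<otimes>\<^bsub>ob G\<^esub> Y) = rep_of k X * rep_of k Y"
      using h' k' X Y by (simp_all add: hom_def)
    then show "rep_of (comp1 h k) (X \<otimes>\<^bsub>ob G\<^esub> Y)
        = rep_of (comp1 h k) X \<otimes>\<^bsub>GL (deg h * deg k)\<^esub> rep_of (comp1 h k) Y"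
      unfolding rep[OF X] rep[OF Y] rep[OF ob.m_closed[OF X Y]] tensor_rep_def mult_GL
      by (simp only: kronecker_mult[OF hc[OF X] kc[OF X] hc[OF Y] kc[OF Y]])
  qed
  moreover have "rep_of (comp1 h k) (cm_bdry G e)
      = (inverse (xi R e) * xi U e) \<cdot>\<^sub>m 1\<^sub>m (deg h * deg k)" if e: "e \<in> carrier (cm_E G)" for e
  proof -
    have "xi T e \<noteq> 0"
      using T e character_nonzero unfolding cat_representation_iff by blast
    then have xi: "inverse (xi R e) * xi T e * (inverse (xi T e) * xi U e) = inverse (xi R e) * xi U e"
      by simp
    have "cm_bdry G e \<in> carrier (ob G)"
      using e by (simp add: cm_bdry_def)
    from rep[OF this] show ?thesis
      using h' k' e unfolding tensor_rep_def by (metis kronecker_smult kronecker_one xi)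
  qed
  ultimately show "one_intertwiner G 1 1 R U (comp1 h k)"
    unfolding one_intertwiner_iff[OF R U] deg using mor cell rep unfolding tensor_rep_def by simp
qed

section \<open>Realization of representations and consequences of the scalar condition\<close>

lemma one_intertwiner_exists:
  assumes R: "cat_representation G 1 R" and T: "cat_representation G 1 T"
    and \<rho>: "\<rho> \<in> hom (ob G) (GL n)"
    and bdry: "\<And>e. e \<in> carrier (cm_E G) \<Longrightarrow>
      \<rho> (cm_bdry G e) = (inverse (xi R e) * xi T e) \<cdot>\<^sub>m 1\<^sub>m n"
  obtains h where "one_intertwiner G 1 1 R T h" "mor h = single n" "deg h = n" "rep_of h = \<rho>"
proof -
  \<comment> \<open>The transpose undoes the one in \<open>lin\<close>, so \<open>rep_of h\<close>
    is \<open>\<rho>\<close> at every argument.\<close>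
  define h where "h = \<lparr>mor = single n, cell = \<lambda>X. single (transpose_mat (\<rho> X))\<rparr>"
  have *: "mor h = single n" "cell h X = single (transpose_mat (\<rho> X))" "deg h = n" for X
    by (simp_all add: h_def deg_def)
  have "rep_of h = \<rho>"
    by (rule ext) (simp add: rep_of_def h_def)
  moreover from this have "one_intertwiner G 1 1 R T h"
    unfolding one_intertwiner_iff[OF R T] using * \<rho> bdry by simp
  ultimately show ?thesis using that * by blast
qed

text \<open>Realize the representation on the zero space, where the scalar condition compares empty
  matrices.\<close>

lemma one_intertwiner_zero:
  assumes R: "cat_representation G 1 R" and T: "cat_representation G 1 T"
  shows "\<exists>h. one_intertwiner G 1 1 R T h \<and> mor h = 0\<^sub>m 1 1"
proof -
  have "(\<lambda>_. 1\<^sub>m 0) \<in> hom (ob G) (GL 0)"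
    by (auto simp: hom_def carrier_GL intro!: bexI[of _ "1\<^sub>m 0"])
  then obtain h where "one_intertwiner G 1 1 R T h" "mor h = single 0"
    by (rule one_intertwiner_exists[OF R T]) (auto intro!: eq_matI)
  moreover have "single 0 = (0\<^sub>m 1 1 :: nat mat)"
    by (intro eq_matI) (auto simp: single_def)
  ultimately show ?thesis by auto
qed

lemma one_intertwiner_cases:
  assumes R: "cat_representation G 1 R" and T: "cat_representation G 1 T"
    and h: "one_intertwiner G 1 1 R T h"
  shows "mor h = 0\<^sub>m 1 1 \<or>
     (deg h > 0 \<and> rep_of h \<in> hom (ob G) (GL (deg h)) \<and>
      (\<forall>e\<in>carrier (cm_E G).
         rep_of h (cm_bdry G e) = (inverse (xi R e) * xi T e) \<cdot>\<^sub>m 1\<^sub>m (deg h)))"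
proof (cases "deg h = 0")
  case True
  moreover have "mor h = single (deg h)"
    using h unfolding one_intertwiner_iff[OF R T] by blast
  ultimately have "mor h = 0\<^sub>m 1 1"
    by (intro eq_matI) (auto simp: single_def)
  then show ?thesis ..
next
  case False
  then show ?thesis
    using h unfolding one_intertwiner_iff[OF R T] by blast
qed

text \<open>On the kernel of the boundary the prescribed scalar matrix is the value at the unit
  object, hence the identity.\<close>

lemma one_intertwiner_kernel:
  assumes R: "cat_representation G 1 R" and T: "cat_representation G 1 T"
    and h: "one_intertwiner G 1 1 R T h" and nz: "mor h \<noteq> 0\<^sub>m 1 1"
    and e: "e \<in> kernel (cm_E G) (ob G) (cm_bdry G)"
  shows "xi R e = xi T e"
proof -
  have E: "e \<in> carrier (cm_E G)" and bdry: "cm_bdry G e = \<one>\<^bsub>ob G\<^esub>"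
    using e by (auto simp: kernel_def)
  have n: "deg h > 0" and hom: "rep_of h \<in> hom (ob G) (GL (deg h))"
    and rep: "rep_of h \<one>\<^bsub>ob G\<^esub> = (inverse (xi R e) * xi T e) \<cdot>\<^sub>m 1\<^sub>m (deg h)"
    using one_intertwiner_cases[OF R T h] nz E unfolding bdry[symmetric] by blast+
  have "rep_of h \<one>\<^bsub>ob G\<^esub> = 1\<^sub>m (deg h)"
    using hom_one[OF hom ob.is_group group_GL] by simp
  \<comment> \<open>A nonzero intertwiner has positive degree, so this entry exists and the scalar
    can be read off.\<close>
  then have "1\<^sub>m (deg h) $$ (0, 0) = ((inverse (xi R e) * xi T e) \<cdot>\<^sub>m 1\<^sub>m (deg h)) $$ (0, 0)"
    unfolding rep by simp
  then have "inverse (xi R e) * xi T e = 1"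
    using n by simp
  then show ?thesis
    by (metis inverse_inverse_eq inverse_unique)
qed

lemma one_intertwiner_self:
  assumes R: "cat_representation G 1 R" and h: "one_intertwiner G 1 1 R R h"
    and e: "e \<in> carrier (cm_E G)"
  shows "rep_of h (cm_bdry G e) = 1\<^sub>m (deg h)"
proof -
  have "xi R e \<noteq> 0"
    using R e character_nonzero unfolding cat_representation_iff by blast
  then have "inverse (xi R e) * xi R e = 1" by simp
  moreover have "rep_of h (cm_bdry G e) = (inverse (xi R e) * xi R e) \<cdot>\<^sub>m 1\<^sub>m (deg h)"
    using h e unfolding one_intertwiner_iff[OF R R] by blast
  ultimately show ?thesis
    by (auto intro!: eq_matI)
qed

section \<open>2-intertwiners as ordinary intertwiners\<close>

lemma two_intertwiner_iff:
  assumes R: "cat_representation G 1 R" and T: "cat_representation G 1 T"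
    and h: "one_intertwiner G 1 1 R T h" and k: "one_intertwiner G 1 1 R T k"
  shows "two_intertwiner G R T h k \<phi> \<longleftrightarrow>
    \<phi> = single (transpose_mat (lin \<phi>)) \<and>
    lin \<phi> \<in> ordinary_intertwiners (ob G) (deg h) (rep_of h) (deg k) (rep_of k)"
proof -
  note h' = h[unfolded one_intertwiner_iff[OF R T]] and k' = k[unfolded one_intertwiner_iff[OF R T]]
  note hc = one_intertwiner_carrier[OF R T h] and kc = one_intertwiner_carrier[OF R T k]
  have ob: "on_ob R X = single 1" "on_ob T X = single 1" if "X \<in> carrier (ob G)" for X
    using R T that unfolding cat_representation_iff by blast+
  have hom2: "\<phi> \<in> hom2 (mor h) (mor k) \<longleftrightarrow>
      \<phi> = single (transpose_mat (lin \<phi>)) \<and> lin \<phi> \<in> carrier_mat (deg k) (deg h)"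
  proof -
    have "\<phi> \<in> hom2 (mor h) (mor k) \<longleftrightarrow> (\<exists>A\<in>carrier_mat (deg h) (deg k). \<phi> = single A)"
      using h' k' hom2_single[of \<phi> "deg h" "deg k"] by metis
    also have "\<dots> \<longleftrightarrow> \<phi> = single (transpose_mat (lin \<phi>)) \<and> lin \<phi> \<in> carrier_mat (deg k) (deg h)"
    proof
      assume "\<exists>A\<in>carrier_mat (deg h) (deg k). \<phi> = single A"
      then show "\<phi> = single (transpose_mat (lin \<phi>)) \<and> lin \<phi> \<in> carrier_mat (deg k) (deg h)"
        by auto
    next
      assume "\<phi> = single (transpose_mat (lin \<phi>)) \<and> lin \<phi> \<in> carrier_mat (deg k) (deg h)"
      then show "\<exists>A\<in>carrier_mat (deg h) (deg k). \<phi> = single A"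
        by (intro bexI[of _ "transpose_mat (lin \<phi>)"]) (blast, simp)
    qed
    finally show ?thesis .
  qed
  \<comment> \<open>Whiskering by one-dimensional identities is trivial, so the condition is an
    equation of two matrix products; its transpose is the ordinary intertwining relation from
    \<open>rep_of h\<close> to \<open>rep_of k\<close>.\<close>
  have nat: "vcomp2 (cell h X) (hcomp2 \<phi> (id2 (on_ob T X)))
        = vcomp2 (hcomp2 (id2 (on_ob R X)) \<phi>) (cell k X) \<longleftrightarrow>
      lin \<phi> * rep_of h X = rep_of k X * lin \<phi>"
    if \<phi>: "\<phi> = single (transpose_mat B)" and B: "B \<in> carrier_mat (deg k) (deg h)"
      and X: "X \<in> carrier (ob G)" for X B
  proof -
    have cells: "cell h X = single (transpose_mat (rep_of h X))" "cell k X = single (transpose_mat (rep_of k X))"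
      using h' k' X by blast+
    have "vcomp2 (cell h X) (hcomp2 \<phi> (id2 (on_ob T X)))
        = vcomp2 (hcomp2 (id2 (on_ob R X)) \<phi>) (cell k X) \<longleftrightarrow>
      transpose_mat (rep_of h X) * transpose_mat B = transpose_mat B * transpose_mat (rep_of k X)"
      by (simp add: \<phi> cells ob[OF X])
    also have "\<dots> \<longleftrightarrow> transpose_mat (B * rep_of h X) = transpose_mat (rep_of k X * B)"
      unfolding transpose_mult[OF B hc[OF X]] transpose_mult[OF kc[OF X] B] ..
    also have "\<dots> \<longleftrightarrow> lin \<phi> * rep_of h X = rep_of k X * lin \<phi>"
      by (simp add: \<phi>)
    finally show ?thesis .
  qed
  show ?thesis
    unfolding two_intertwiner_def ordinary_intertwiners_def hom2 using nat by blast
qed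

lemma two_intertwiner_bij:
  assumes R: "cat_representation G 1 R" and T: "cat_representation G 1 T"
    and h: "one_intertwiner G 1 1 R T h" and k: "one_intertwiner G 1 1 R T k"
  shows "bij_betw lin {\<phi>. two_intertwiner G R T h k \<phi>}
    (ordinary_intertwiners (ob G) (deg h) (rep_of h) (deg k) (rep_of k))"
proof (rule bij_betw_byWitness[where f' = "\<lambda>B. single (transpose_mat B)"])
  note iff = two_intertwiner_iff[OF R T h k]
  show "\<forall>\<phi>\<in>{\<phi>. two_intertwiner G R T h k \<phi>}. single (transpose_mat (lin \<phi>)) = \<phi>"
    unfolding iff by simp
  show "lin ` {\<phi>. two_intertwiner G R T h k \<phi>}
      \<subseteq> ordinary_intertwiners (ob G) (deg h) (rep_of h) (deg k) (rep_of k)"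
    unfolding iff by blast
  show "(\<lambda>B. single (transpose_mat B)) ` ordinary_intertwiners (ob G) (deg h) (rep_of h) (deg k) (rep_of k)
      \<subseteq> {\<phi>. two_intertwiner G R T h k \<phi>}"
    unfolding iff by auto
qed simp

text \<open>Transposition reverses the diagrammatic order, so doing \<open>\<phi>\<close> first puts
  \<open>lin \<phi>\<close> on the right, as for composition of linear maps.\<close>

lemma two_intertwiner_vcomp:
  assumes R: "cat_representation G 1 R" and T: "cat_representation G 1 T"
    and h: "one_intertwiner G 1 1 R T h" and k: "one_intertwiner G 1 1 R T k"
    and l: "one_intertwiner G 1 1 R T l"
    and \<phi>: "two_intertwiner G R T h k \<phi>" and \<psi>: "two_intertwiner G R T k l \<psi>"
  shows "two_intertwiner G R T h l (vcomp2 \<phi> \<psi>)" and "lin (vcomp2 \<phi> \<psi>) = lin \<psi> * lin \<phi>"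
proof -
  note c = one_intertwiner_carrier[OF R T]
  have \<phi>': "\<phi> = single (transpose_mat (lin \<phi>))" and \<phi>o: "lin \<phi> \<in> ordinary_intertwiners (ob G) (deg h) (rep_of h) (deg k) (rep_of k)"
    using \<phi> unfolding two_intertwiner_iff[OF R T h k] by blast+
  have \<psi>': "\<psi> = single (transpose_mat (lin \<psi>))" and \<psi>o: "lin \<psi> \<in> ordinary_intertwiners (ob G) (deg k) (rep_of k) (deg l) (rep_of l)"
    using \<psi> unfolding two_intertwiner_iff[OF R T k l] by blast+
  have eq: "vcomp2 \<phi> \<psi> = single (transpose_mat (lin \<psi> * lin \<phi>))"
    using \<phi>o \<psi>o unfolding ordinary_intertwiners_def
    by (subst \<phi>', subst \<psi>') (auto simp: transpose_mult)
  then show lin: "lin (vcomp2 \<phi> \<psi>) = lin \<psi> * lin \<phi>" by simp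
  have "lin \<psi> * lin \<phi> \<in> ordinary_intertwiners (ob G) (deg h) (rep_of h) (deg l) (rep_of l)"
    by (rule ordinary_intertwiners_mult[OF \<phi>o \<psi>o c[OF h] c[OF k] c[OF l]])
  with eq show "two_intertwiner G R T h l (vcomp2 \<phi> \<psi>)"
    unfolding two_intertwiner_iff[OF R T h l] lin by blast
qed

lemma two_intertwiner_hcomp:
  assumes R: "cat_representation G 1 R" and T: "cat_representation G 1 T"
    and U: "cat_representation G 1 U"
    and h: "one_intertwiner G 1 1 R T h" and h': "one_intertwiner G 1 1 R T h'"
    and k: "one_intertwiner G 1 1 T U k" and k': "one_intertwiner G 1 1 T U k'"
    and \<phi>: "two_intertwiner G R T h h' \<phi>" and \<psi>: "two_intertwiner G T U k k' \<psi>"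
  shows "two_intertwiner G R U (comp1 h k) (comp1 h' k') (hcomp2 \<phi> \<psi>)"
    and "lin (hcomp2 \<phi> \<psi>) = kronecker (lin \<phi>) (lin \<psi>)"
proof -
  note c = one_intertwiner_carrier[OF R T] and d = one_intertwiner_carrier[OF T U]
  note hk = comp1_intertwiner[OF R T U h k] and hk' = comp1_intertwiner[OF R T U h' k']
  have \<phi>': "\<phi> = single (transpose_mat (lin \<phi>))" and \<phi>o: "lin \<phi> \<in> ordinary_intertwiners (ob G) (deg h) (rep_of h) (deg h') (rep_of h')"
    using \<phi> unfolding two_intertwiner_iff[OF R T h h'] by blast+
  have \<psi>': "\<psi> = single (transpose_mat (lin \<psi>))" and \<psi>o: "lin \<psi> \<in> ordinary_intertwiners (ob G) (deg k) (rep_of k) (deg k') (rep_of k')"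
    using \<psi> unfolding two_intertwiner_iff[OF T U k k'] by blast+
  have eq: "hcomp2 \<phi> \<psi> = single (transpose_mat (kronecker (lin \<phi>) (lin \<psi>)))"
    by (subst \<phi>', subst \<psi>') (simp add: kronecker_transpose)
  then show lin: "lin (hcomp2 \<phi> \<psi>) = kronecker (lin \<phi>) (lin \<psi>)" by simp
  have "kronecker (lin \<phi>) (lin \<psi>) \<in> ordinary_intertwiners (ob G) (deg h * deg k)
      (tensor_rep (rep_of h) (rep_of k)) (deg h' * deg k') (tensor_rep (rep_of h') (rep_of k'))"
    by (rule ordinary_intertwiners_kronecker[OF \<phi>o \<psi>o c[OF h] c[OF h'] d[OF k] d[OF k']])
  \<comment> \<open>The composites have the tensor products as their representations only on objects
    of \<open>G\<close>, and intertwining is tested only there.\<close>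
  then have "kronecker (lin \<phi>) (lin \<psi>) \<in> ordinary_intertwiners (ob G) (deg (comp1 h k))
      (rep_of (comp1 h k)) (deg (comp1 h' k')) (rep_of (comp1 h' k'))"
    unfolding ordinary_intertwiners_def by (simp add: hk hk')
  with eq show "two_intertwiner G R U (comp1 h k) (comp1 h' k') (hcomp2 \<phi> \<psi>)"
    unfolding two_intertwiner_iff[OF R U hk(1) hk'(1)] lin by blast
qed

end

section \<open>The classification of one-dimensional representations, 1-intertwiners and
  2-intertwiners\<close>

theorem theorem5p1:
  fixes G :: "('o, 'm) catgroup"
  assumes "categorical_group G"
  shows
    "\<comment> \<open>(a)\<close>
     (\<forall>R. cat_representation G 1 R \<longrightarrow> invariant_character G (xi R)) \<and>
     (\<forall>R R'. cat_representation G 1 R \<and> cat_representation G 1 R' \<and>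
        (\<forall>e\<in>carrier (cm_E G). xi R e = xi R' e) \<longrightarrow>
        (\<forall>X\<in>carrier (ob G). on_ob R X = on_ob R' X) \<and>
        (\<forall>f\<in>carrier (ar G). on_ar R f = on_ar R' f)) \<and>
     (\<forall>\<chi>. invariant_character G \<chi> \<longrightarrow>
        (\<exists>R. cat_representation G 1 R \<and> (\<forall>e\<in>carrier (cm_E G). xi R e = \<chi> e))) \<and>
     \<comment> \<open>(b): the representation of an intertwiner\<close>
     (\<forall>R T. cat_representation G 1 R \<and> cat_representation G 1 T \<longrightarrow>
        (\<forall>h. one_intertwiner G 1 1 R T h \<longrightarrow>
           mor h = 0\<^sub>m 1 1 \<or>
           (deg h > 0 \<and> rep_of h \<in> hom (ob G) (GL (deg h)) \<and>
            (\<forall>e\<in>carrier (cm_E G).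
               rep_of h (cm_bdry G e) = (inverse (xi R e) * xi T e) \<cdot>\<^sub>m 1\<^sub>m (deg h)))) \<and>
        (\<forall>h k. one_intertwiner G 1 1 R T h \<and> one_intertwiner G 1 1 R T k \<and>
           deg h = deg k \<and> (\<forall>X\<in>carrier (ob G). rep_of h X = rep_of k X) \<longrightarrow>
           mor h = mor k \<and> (\<forall>X\<in>carrier (ob G). cell h X = cell k X)) \<and>
        (\<exists>h. one_intertwiner G 1 1 R T h \<and> mor h = 0\<^sub>m 1 1) \<and>
        (\<forall>n \<rho>. n > 0 \<and> \<rho> \<in> hom (ob G) (GL n) \<and>
           (\<forall>e\<in>carrier (cm_E G).
              \<rho> (cm_bdry G e) = (inverse (xi R e) * xi T e) \<cdot>\<^sub>m 1\<^sub>m n) \<longrightarrow>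
           (\<exists>h. one_intertwiner G 1 1 R T h \<and> deg h = n \<and>
                (\<forall>X\<in>carrier (ob G). rep_of h X = \<rho> X))) \<and>
        ((\<exists>e\<in>kernel (cm_E G) (ob G) (cm_bdry G). xi R e \<noteq> xi T e) \<longrightarrow>
           \<not> (\<exists>h. one_intertwiner G 1 1 R T h \<and> mor h \<noteq> 0\<^sub>m 1 1))) \<and>
     (\<forall>R h. cat_representation G 1 R \<and> one_intertwiner G 1 1 R R h \<longrightarrow>
        (\<forall>e\<in>carrier (cm_E G). rep_of h (cm_bdry G e) = 1\<^sub>m (deg h))) \<and>
     \<comment> \<open>(b): composition\<close>
     (\<forall>R T U h k. cat_representation G 1 R \<and> cat_representation G 1 T \<and>
        cat_representation G 1 U \<and>
        one_intertwiner G 1 1 R T h \<and> one_intertwiner G 1 1 T U k \<longrightarrow>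
        one_intertwiner G 1 1 R U (comp1 h k) \<and>
        deg (comp1 h k) = deg h * deg k \<and>
        (\<forall>X\<in>carrier (ob G). rep_of (comp1 h k) X = tensor_rep (rep_of h) (rep_of k) X)) \<and>
     \<comment> \<open>(c)\<close>
     (\<forall>R T h k. cat_representation G 1 R \<and> cat_representation G 1 T \<and>
        one_intertwiner G 1 1 R T h \<and> one_intertwiner G 1 1 R T k \<longrightarrow>
        bij_betw lin {\<phi>. two_intertwiner G R T h k \<phi>}
          (ordinary_intertwiners (ob G) (deg h) (rep_of h) (deg k) (rep_of k))) \<and>
     (\<forall>R T U h h' k k' \<phi> \<psi>. cat_representation G 1 R \<and> cat_representation G 1 T \<and>
        cat_representation G 1 U \<and>
        one_intertwiner G 1 1 R T h \<and> one_intertwiner G 1 1 R T h' \<and>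
        one_intertwiner G 1 1 T U k \<and> one_intertwiner G 1 1 T U k' \<and>
        two_intertwiner G R T h h' \<phi> \<and> two_intertwiner G T U k k' \<psi> \<longrightarrow>
        two_intertwiner G R U (comp1 h k) (comp1 h' k') (hcomp2 \<phi> \<psi>) \<and>
        lin (hcomp2 \<phi> \<psi>) = kronecker (lin \<phi>) (lin \<psi>)) \<and>
     (\<forall>R T h k l \<phi> \<psi>. cat_representation G 1 R \<and> cat_representation G 1 T \<and>
        one_intertwiner G 1 1 R T h \<and> one_intertwiner G 1 1 R T k \<and>
        one_intertwiner G 1 1 R T l \<and>
        two_intertwiner G R T h k \<phi> \<and> two_intertwiner G R T k l \<psi> \<longrightarrow>
        two_intertwiner G R T h l (vcomp2 \<phi> \<psi>) \<and>
        lin (vcomp2 \<phi> \<psi>) = lin \<psi> * lin \<phi>)"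
proof -
  interpret categorical_group G by (rule assms)
  show ?thesis
  \<comment> \<open>Goals 1 to 4 belong to (a), goals 5 to 14 to (b), and goals 15 to 19 to
    (c).\<close>
  proof ((intro conjI allI impI; (elim conjE)?), goal_cases)
    case (1 R)
    then show ?case unfolding cat_representation_iff by blast
  next
    case (2 R R')
    then show ?case unfolding cat_representation_iff by simp
  next
    case (3 R R')
    then show ?case unfolding cat_representation_iff using to_E_closed by simp
  next
    case (4 \<chi>)
    then show ?case by (rule cat_representation_exists)
  next
    case (5 R T h)
    then show ?case by (intro one_intertwiner_cases)
  next
    case (6 R T h k)
    \<comment> \<open>The characterization expresses \<open>mor\<close> through \<open>deg\<close>
      and each \<open>cell\<close> through \<open>rep_of\<close>, so equal degrees and
      representations give equal intertwiners.\<close>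
    then show ?case using one_intertwiner_iff by metis
  next
    case (7 R T h k)
    then show ?case using one_intertwiner_iff by metis
  next
    case (8 R T)
    then show ?case by (rule one_intertwiner_zero)
  next
    case (9 R T n \<rho>)
    then show ?case using one_intertwiner_exists[of R T \<rho> n] by metis
  next
    case (10 R T)
    then show ?case using one_intertwiner_kernel by blast
  next
    case (11 R h)
    then show ?case using one_intertwiner_self by blast
  next
    case (12 R T U h k)
    then show ?case by (rule comp1_intertwiner)
  next
    case (13 R T U h k)
    then show ?case by (rule comp1_intertwiner)
  next
    case (14 R T U h k)
    then show ?case using comp1_intertwiner by blast
  next
    case (15 R T h k)
    then show ?case by (rule two_intertwiner_bij)
  next
    case (16 R T U h h' k k' \<phi> \<psi>)
    then show ?case by (rule two_intertwiner_hcomp)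
  next
    case (17 R T U h h' k k' \<phi> \<psi>)
    then show ?case by (rule two_intertwiner_hcomp)
  next
    case (18 R T h k l \<phi> \<psi>)
    then show ?case by (rule two_intertwiner_vcomp)
  next
    case (19 R T h k l \<phi> \<psi>)
    then show ?case by (rule two_intertwiner_vcomp)
  qed
qed

end
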